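(* Let $\alpha_1>-1$ and $\alpha>-\min(1,1+\alpha_1)$. For the Laguerre $\beta$-ensemble with $\beta=2\alpha/N$, let $m^{\rm L}_{p,0}$, $m^{\rm L}_{p,1}$ be the leading and first-correction moments and $\tilde\mu^{\rm L}_{p,0}$ the summed leading covariances (see context). Then, with $m^{\rm L}_{0,1}=0$, for all integers $p\ge0$, $$m_{p+1,1}^{\rm L}=-\alpha(p+1)\,m_{p,0}^{\rm L}+(p+1+\alpha_1+2\alpha)\,m_{p,1}^{\rm L}+\alpha\,\tilde\mu_{p,0}^{\rm L}+2\alpha\sum_{l=1}^{p-1}m_{l,1}^{\rm L}\,m_{p-l,0}^{\rm L},$$ where $\tilde\mu^{\rm L}_{0,0}=0$ and $\{\tilde\mu^{\rm L}_{p,0}\}$ satisfies, for all $p\ge0$, $$\tilde\mu_{p+1,0}^{\rm L}=\tfrac12(p+2+2\alpha_1+4\alpha)\,\tilde\mu_{p,0}^{\rm L}+\frac{p(p+1)}2\,m_{p,0}^{\rm L}+2\alpha\sum_{s=1}^{p-1}\tilde\mu_{s,0}^{\rm L}\,m_{p-s,0}^{\rm L}.$$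
   Context: The Laguerre $\beta$-ensemble is the probability density on $(0,\infty)^N$ proportional to $\prod_{l=1}^N\lambda_l^{\alpha_1}e^{-\lambda_l}\prod_{1\le j<k\le N}|\lambda_k-\lambda_j|^\beta$. Here $\beta=2\alpha/N$ with $\alpha,\alpha_1$ fixed, and $N\to\infty$. Standing assumption (large-$N$ ansatz): for every $n\ge1$ and all integers $p_1,\dots,p_n\ge0$, the joint cumulant of $\sum_j\lambda_j^{p_1},\dots,\sum_j\lambda_j^{p_n}$ (with $\beta=2\alpha/N$) has, as $N\to\infty$, an asymptotic expansion $N\sum_{l\ge0}c^{(l)}_{p_1,\dots,p_n}N^{-l}$ with coefficients independent of $N$. $m^{\rm L}_{p,0},m^{\rm L}_{p,1}$ are defined by $\frac1N\big\langle\sum_{j=1}^N\lambda_j^p\big\rangle=m^{\rm L}_{p,0}+\frac1Nm^{\rm L}_{p,1}+O(N^{-2})$; $\mu^{\rm L}_{(p,q),0}=\lim_{N\to\infty}\frac1N{\rm Cov}\big(\sum_i\lambda_i^p,\sum_i\lambda_i^q\big)$; $\tilde\mu^{\rm L}_{p,0}=\sum_{p_1+q_1=p,\;p_1,q_1\ge0}\mu^{\rm L}_{(p_1,q_1),0}$. Empty sums are zero. *)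

theory Defs
  imports "HOL-Probability.Probability" "HOL-Library.Landau_Symbols"
begin

definition laguerre_weight :: "real \<Rightarrow> real \<Rightarrow> nat \<Rightarrow> (nat \<Rightarrow> real) \<Rightarrow> real" where
  "laguerre_weight a \<beta> N x =
     (if \<forall>l<N. 0 < x l
      then (\<Prod>l<N. x l powr a * exp (- x l)) * (\<Prod>k<N. \<Prod>j<k. \<bar>x k - x j\<bar> powr \<beta>)
      else 0)"

text \<open>
  Points of \<open>\<real>\<^sup>N\<close> are functions on \<open>{..<N}\<close>, with the product Lebesgue measure.
  The partition function \<open>Z\<close> is finite and positive in the parameter range of interest.
\<close>

definition laguerre_partition :: "real \<Rightarrow> real \<Rightarrow> nat \<Rightarrow> real" where
  "laguerre_partition a \<beta> N =
     (\<integral>x. laguerre_weight a \<beta> N x \<partial>(\<Pi>\<^sub>M i\<in>{..<N}. lborel))"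

definition laguerre_ensemble :: "real \<Rightarrow> real \<Rightarrow> nat \<Rightarrow> (nat \<Rightarrow> real) measure" where
  "laguerre_ensemble a \<beta> N =
     density (\<Pi>\<^sub>M i\<in>{..<N}. lborel)
       (\<lambda>x. ennreal (laguerre_weight a \<beta> N x / laguerre_partition a \<beta> N))"

definition power_sum :: "nat \<Rightarrow> nat \<Rightarrow> (nat \<Rightarrow> real) \<Rightarrow> real" where
  "power_sum N p x = (\<Sum>j<N. x j ^ p)"

definition covariance :: "'a measure \<Rightarrow> ('a \<Rightarrow> real) \<Rightarrow> ('a \<Rightarrow> real) \<Rightarrow> real" where
  "covariance M X Y =
     (\<integral>x. X x * Y x \<partial>M) - (\<integral>x. X x \<partial>M) * (\<integral>x. Y x \<partial>M)"

text \<open>Joint cumulant of a list of random variables, by the moment-cumulant formula over set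
  partitions of the index set (so repeated entries count as distinct arguments).\<close>

definition joint_cumulant :: "'a measure \<Rightarrow> ('a \<Rightarrow> real) list \<Rightarrow> real" where
  "joint_cumulant M Xs =
     (\<Sum>P | partition_on {..<length Xs} P.
        (- 1) ^ (card P - 1) * fact (card P - 1) *
        (\<Prod>B\<in>P. \<integral>x. (\<Prod>i\<in>B. (Xs ! i) x) \<partial>M))"

text \<open>The high-temperature scaling: \<open>\<beta> = 2\<alpha>/N\<close>.\<close>

definition laguerre_high_temp :: "real \<Rightarrow> real \<Rightarrow> nat \<Rightarrow> (nat \<Rightarrow> real) measure" where
  "laguerre_high_temp a \<alpha> N = laguerre_ensemble a (2 * \<alpha> / real N) N"

text \<open>The ansatz is a Poincare-type expansion: for every truncation order \<open>L\<close> the remainder is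
  of the order of the first omitted term.\<close>

definition large_N_ansatz :: "real \<Rightarrow> real \<Rightarrow> bool" where
  "large_N_ansatz a \<alpha> \<longleftrightarrow>
     (\<forall>ps. ps \<noteq> [] \<longrightarrow>
        (\<exists>c :: nat \<Rightarrow> real. \<forall>L.
           (\<lambda>N. joint_cumulant (laguerre_high_temp a \<alpha> N) (map (power_sum N) ps)
                - real N * (\<Sum>l<L. c l / real N ^ l))
             \<in> O(\<lambda>N. real N / real N ^ L)))"

definition moment_expansion :: "real \<Rightarrow> real \<Rightarrow> nat \<Rightarrow> real \<Rightarrow> real \<Rightarrow> bool" where
  "moment_expansion a \<alpha> p m0 m1 \<longleftrightarrow>
     (\<lambda>N. (\<integral>x. power_sum N p x \<partial>(laguerre_high_temp a \<alpha> N)) / real N - (m0 + m1 / real N))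
       \<in> O(\<lambda>N. 1 / real N ^ 2)"

definition moment0 :: "real \<Rightarrow> real \<Rightarrow> nat \<Rightarrow> real" where
  "moment0 a \<alpha> p = (THE m0. \<exists>m1. moment_expansion a \<alpha> p m0 m1)"

definition moment1 :: "real \<Rightarrow> real \<Rightarrow> nat \<Rightarrow> real" where
  "moment1 a \<alpha> p = (THE m1. \<exists>m0. moment_expansion a \<alpha> p m0 m1)"

definition cov0 :: "real \<Rightarrow> real \<Rightarrow> nat \<Rightarrow> nat \<Rightarrow> real" where
  "cov0 a \<alpha> p q =
     lim (\<lambda>N. covariance (laguerre_high_temp a \<alpha> N) (power_sum N p) (power_sum N q) / real N)"

definition summed_cov0 :: "real \<Rightarrow> real \<Rightarrow> nat \<Rightarrow> real" where
  "summed_cov0 a \<alpha> p = (\<Sum>(p1, q1) | p1 + q1 = p. cov0 a \<alpha> p1 q1)"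

end

theory Submission
  imports Defs
begin

text \<open>
  Invariance of the integral of \<open>power_sum q\<close> times the weight under the coordinatewise change of
  variables \<open>x + t * x ^ (p + 1)\<close>, differentiated at \<open>t = 0+\<close>, gives the loop equation
  \<open>q \<langle>P\<^sub>p\<^sub>+\<^sub>q\<rangle> + (p + 1 + a) \<langle>P\<^sub>p P\<^sub>q\<rangle> - \<langle>P\<^sub>p\<^sub>+\<^sub>1 P\<^sub>q\<rangle> + (\<beta> / 2) ((\<Sum>r\<le>p. \<langle>P\<^sub>r P\<^sub>p\<^sub>-\<^sub>r P\<^sub>q\<rangle>) - (p + 1) \<langle>P\<^sub>p P\<^sub>q\<rangle>) = 0\<close>.
  For \<open>q = 0\<close> it expresses the moments through covariances, and its order \<open>1/N\<close> is the recurrence for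
  \<open>moment1\<close>. Subtracting \<open>\<langle>P\<^sub>q\<rangle>\<close> times the case \<open>q = 0\<close> leaves covariances and a third cumulant that
  is negligible by the ansatz; the leading order, summed over \<open>p + q = n\<close>, is the recurrence for
  \<open>summed_cov0\<close>.

  The partition function is never shown to be finite or positive: if it is not, the ensemble is the
  null measure by the conventions for divergent integrals and division by \<open>0\<close>, and the loop equations hold
  trivially.
\<close>

section \<open>Coordinatewise substitution on the orthant\<close>

text \<open>Monotone convergence from the substitution rule on the intervals
  \<open>{0..s n}\<close>. The endpoint \<open>0\<close>, a null set, is added and removed so that
  the result lives on the open half-line, where the weight is supported.\<close>

lemma nn_integral_substitution_half_line:
  fixes f f' :: "real \<Rightarrow> real" and h :: "real \<Rightarrow> ennreal"
  assumes h[measurable]: "h \<in> borel_measurable borel"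
    and df: "\<And>x. 0 \<le> x \<Longrightarrow> (f has_real_derivative f' x) (at x)"
    and cf: "continuous_on {0..} f'"
    and f'0: "\<And>x. 0 \<le> x \<Longrightarrow> 0 \<le> f' x"
    and f0: "f 0 = 0" and ftop: "filterlim f at_top at_top"
    and f'm[measurable]: "f' \<in> borel_measurable borel"
    and fm[measurable]: "f \<in> borel_measurable borel"
  shows "(\<integral>\<^sup>+x. h x * indicator {0<..} x \<partial>lborel)
       = (\<integral>\<^sup>+x. h (f x) * ennreal (f' x) * indicator {0<..} x \<partial>lborel)"
proof -
  have ne: "AE x in lborel. x \<noteq> (0::real)"
    by (rule AE_lborel_singleton)
  have fmono: "f x \<le> f y" if "0 \<le> x" "x \<le> y" for x y
    by (rule DERIV_nonneg_imp_nondecreasing[OF that(2)]) (use that df f'0 order_trans in blast)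
  define s where "s n = real (Suc n)" for n
  have spos: "0 < s n" for n by (simp add: s_def)
  have step: "(\<integral>\<^sup>+x. h x * indicator {0..f (s n)} x \<partial>lborel)
       = (\<integral>\<^sup>+x. h (f x) * ennreal (f' x) * indicator {0..s n} x \<partial>lborel)" for n
    using nn_integral_substitution_aux[where f=h and g=f and g'=f' and a=0 and b="s n"]
    using continuous_on_subset[OF cf, of "{0..s n}"] by (auto simp: f0 spos df f'0)
  have stop: "filterlim s at_top sequentially"
    unfolding s_def by (rule filterlim_compose[OF filterlim_real_sequentially filterlim_Suc])
  have l1: "(\<lambda>n. \<integral>\<^sup>+x. h x * indicator {0..f (s n)} x \<partial>lborel)
      \<longlonglongrightarrow> (\<integral>\<^sup>+x. h x * indicator {0..} x \<partial>lborel)"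
  proof (rule nn_integral_LIMSEQ)
    show "incseq (\<lambda>n x. h x * indicator {0..f (s n)} x)"
    proof (intro incseq_SucI le_funI)
      fix n x
      have "f (s n) \<le> f (s (Suc n))" by (rule fmono) (auto simp: s_def)
      then show "h x * indicator {0..f (s n)} x \<le> h x * indicator {0..f (s (Suc n))} x"
        by (auto split: split_indicator)
    qed
    show "(\<lambda>x. h x * indicator {0..f (s n)} x) \<in> borel_measurable lborel" for n
      by measurable
    show "(\<lambda>n. h x * indicator {0..f (s n)} x) \<longlonglongrightarrow> h x * indicator {0..} x" for x
    proof (rule tendsto_eventually)
      have "eventually (\<lambda>n. x \<le> f (s n)) sequentially"
        using filterlim_compose[OF ftop stop] by (simp add: filterlim_at_top)
      then show "eventually (\<lambda>n. h x * indicator {0..f (s n)} x = h x * indicator {0..} x) sequentially"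
        by eventually_elim (auto split: split_indicator)
    qed
  qed
  have l2: "(\<lambda>n. \<integral>\<^sup>+x. h (f x) * ennreal (f' x) * indicator {0..s n} x \<partial>lborel)
      \<longlonglongrightarrow> (\<integral>\<^sup>+x. h (f x) * ennreal (f' x) * indicator {0..} x \<partial>lborel)"
  proof (rule nn_integral_LIMSEQ)
    show "incseq (\<lambda>n x. h (f x) * ennreal (f' x) * indicator {0..s n} x)"
      by (auto simp: incseq_def le_fun_def s_def split: split_indicator)
    show "(\<lambda>x. h (f x) * ennreal (f' x) * indicator {0..s n} x) \<in> borel_measurable lborel" for n
      by measurable
    show "(\<lambda>n. h (f x) * ennreal (f' x) * indicator {0..s n} x)
        \<longlonglongrightarrow> h (f x) * ennreal (f' x) * indicator {0..} x" for x
    proof (rule tendsto_eventually)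
      have "eventually (\<lambda>n. x \<le> s n) sequentially"
        using stop by (simp add: filterlim_at_top)
      then show "eventually (\<lambda>n. h (f x) * ennreal (f' x) * indicator {0..s n} x
          = h (f x) * ennreal (f' x) * indicator {0..} x) sequentially"
        by eventually_elim (auto split: split_indicator)
    qed
  qed
  have "(\<integral>\<^sup>+x. h x * indicator {0<..} x \<partial>lborel) = (\<integral>\<^sup>+x. h x * indicator {0..} x \<partial>lborel)"
    by (rule nn_integral_cong_AE, use ne in eventually_elim) (auto split: split_indicator)
  also have "\<dots> = (\<integral>\<^sup>+x. h (f x) * ennreal (f' x) * indicator {0..} x \<partial>lborel)"
    using LIMSEQ_unique[OF l1 l2[folded step]] .
  also have "\<dots> = (\<integral>\<^sup>+x. h (f x) * ennreal (f' x) * indicator {0<..} x \<partial>lborel)"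
    by (rule nn_integral_cong_AE, use ne in eventually_elim) (auto split: split_indicator)
  finally show ?thesis .
qed

lemma prod_indicator_Pi:
  fixes I :: "'i set"
  assumes "finite I"
  shows "(\<Prod>i\<in>I. indicator (A i) (x i) :: 'b::comm_semiring_1) = (if \<forall>i\<in>I. x i \<in> A i then 1 else 0)"
  using assms by (induction I) (auto split: split_indicator)

text \<open>A product measure is determined by its values on boxes, and there the integral
  factorizes into one-dimensional substitutions. Both sides are identified with the product of
  \<open>\<mu>\<close>, Lebesgue measure restricted to the open half-line.\<close>

lemma distr_density_orthant:
  fixes f f' :: "real \<Rightarrow> real" and N :: nat
  assumes df: "\<And>x. 0 \<le> x \<Longrightarrow> (f has_real_derivative f' x) (at x)"
    and cf: "continuous_on {0..} f'"
    and f'0: "\<And>x. 0 \<le> x \<Longrightarrow> 0 \<le> f' x"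
    and f0: "f 0 = 0" and ftop: "filterlim f at_top at_top"
    and f'm[measurable]: "f' \<in> borel_measurable borel"
    and fm[measurable]: "f \<in> borel_measurable borel"
  defines "V \<equiv> (\<Pi>\<^sub>M i\<in>{..<N}. lborel :: real measure)"
  shows "distr (density V (\<lambda>x. \<Prod>i<N. ennreal (f' (x i)) * indicator {0<..} (x i)))
            V (\<lambda>x. \<lambda>i\<in>{..<N}. f (x i))
       = density V (\<lambda>x. \<Prod>i<N. indicator {0<..} (x i))" (is "?L = ?R")
proof -
  define \<mu> where "\<mu> = density lborel (indicator {0<..} :: real \<Rightarrow> ennreal)"
  have sets\<mu>[measurable_cong]: "sets \<mu> = sets borel" by (simp add: \<mu>_def)
  have sfm: "sigma_finite_measure \<mu>"
    unfolding \<mu>_def by (subst sigma_finite_measure.sigma_finite_iff_density_finite) (auto intro: lborel.sigma_finite_measure_axioms split: split_indicator)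
  interpret L: product_sigma_finite "\<lambda>_::nat. lborel :: real measure" ..
  interpret M: product_sigma_finite "\<lambda>_::nat. \<mu>" 
    by (simp add: product_sigma_finite_def sfm)
  have setsPi: "sets V = sets (\<Pi>\<^sub>M i\<in>{..<N}. \<mu>)"
    unfolding V_def by (intro sets_PiM_cong) (simp_all add: sets\<mu>)
  have em: "emeasure \<mu> A = (\<integral>\<^sup>+x. indicator A x * indicator {0<..} x \<partial>lborel)" if "A \<in> sets borel" for A
    using that unfolding \<mu>_def by (subst emeasure_density) (auto intro!: nn_integral_cong split: split_indicator)
  have "?L = (\<Pi>\<^sub>M i\<in>{..<N}. \<mu>)"
  proof (rule M.PiM_eqI)
    fix A assume "\<And>i. i \<in> {..<N} \<Longrightarrow> A i \<in> sets \<mu>"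
    then have A[measurable]: "\<And>i. i \<in> {..<N} \<Longrightarrow> A i \<in> sets borel" by (simp add: sets\<mu>)
    have PA: "Pi\<^sub>E {..<N} A \<in> sets V" unfolding V_def by (rule sets_PiM_I_finite) (use A in auto)
    have mf: "(\<lambda>x. \<lambda>i\<in>{..<N}. f (x i)) \<in> measurable V V"
      unfolding V_def by measurable
    have md: "(\<lambda>x. \<Prod>i<N. ennreal (f' (x i)) * indicator {0<..} (x i)) \<in> borel_measurable V"
      unfolding V_def by measurable
    have "emeasure ?L (Pi\<^sub>E {..<N} A)
       = emeasure (density V (\<lambda>x. \<Prod>i<N. ennreal (f' (x i)) * indicator {0<..} (x i)))
           ((\<lambda>x. \<lambda>i\<in>{..<N}. f (x i)) -` (Pi\<^sub>E {..<N} A) \<inter> space V)"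
      using mf PA by (subst emeasure_distr) (auto simp: measurable_density_eq1)
    also have "\<dots> = (\<integral>\<^sup>+x. (\<Prod>i<N. ennreal (f' (x i)) * indicator {0<..} (x i)) *
        indicator ((\<lambda>x. \<lambda>i\<in>{..<N}. f (x i)) -` (Pi\<^sub>E {..<N} A) \<inter> space V) x \<partial>V)"
      by (subst emeasure_density[OF md measurable_sets[OF mf PA]]) simp
    also have "\<dots> = (\<integral>\<^sup>+x. (\<Prod>i<N. indicator (A i) (f (x i)) * ennreal (f' (x i)) * indicator {0<..} (x i)) \<partial>V)"
    proof (rule nn_integral_cong)
      fix x assume "x \<in> space V"
      then have "indicator ((\<lambda>x. \<lambda>i\<in>{..<N}. f (x i)) -` (Pi\<^sub>E {..<N} A) \<inter> space V) x
         = (\<Prod>i<N. indicator (A i) (f (x i)) :: ennreal)"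
        by (subst prod_indicator_Pi) (auto split: split_indicator)
      then show "(\<Prod>i<N. ennreal (f' (x i)) * indicator {0<..} (x i)) *
        indicator ((\<lambda>x. \<lambda>i\<in>{..<N}. f (x i)) -` (Pi\<^sub>E {..<N} A) \<inter> space V) x
        = (\<Prod>i<N. indicator (A i) (f (x i)) * ennreal (f' (x i)) * indicator {0<..} (x i))"
        by (simp add: prod.distrib mult_ac)
    qed
    also have "\<dots> = (\<Prod>i<N. \<integral>\<^sup>+x. indicator (A i) (f x) * ennreal (f' x) * indicator {0<..} x \<partial>lborel)"
      unfolding V_def using A by (intro L.product_nn_integral_prod) (auto intro!: borel_measurable_times_ennreal)
    also have "\<dots> = (\<Prod>i<N. emeasure \<mu> (A i))"
    proof (rule prod.cong[OF refl])
      fix i assume i: "i \<in> {..<N}"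
      show "(\<integral>\<^sup>+x. indicator (A i) (f x) * ennreal (f' x) * indicator {0<..} x \<partial>lborel) = emeasure \<mu> (A i)"
        unfolding em[OF A[OF i]] using A[OF i]
        by (intro nn_integral_substitution_half_line[symmetric, OF _ df cf f'0 f0 ftop f'm fm]) auto
    qed
    finally show "emeasure ?L (Pi\<^sub>E {..<N} A) = (\<Prod>i<N. emeasure \<mu> (A i))" .
  qed (simp_all add: setsPi)
  moreover have "?R = (\<Pi>\<^sub>M i\<in>{..<N}. \<mu>)"
  proof (rule M.PiM_eqI)
    fix A assume "\<And>i. i \<in> {..<N} \<Longrightarrow> A i \<in> sets \<mu>"
    then have A[measurable]: "\<And>i. i \<in> {..<N} \<Longrightarrow> A i \<in> sets borel" by (simp add: sets\<mu>)
    have PA: "Pi\<^sub>E {..<N} A \<in> sets V" unfolding V_def by (rule sets_PiM_I_finite) (use A in auto)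
    have md: "(\<lambda>x. \<Prod>i<N. indicator {0<..} (x i) :: ennreal) \<in> borel_measurable V"
      unfolding V_def by measurable
    have "emeasure ?R (Pi\<^sub>E {..<N} A) = (\<integral>\<^sup>+x. (\<Prod>i<N. indicator {0<..} (x i)) * indicator (Pi\<^sub>E {..<N} A) x \<partial>V)"
      by (rule emeasure_density[OF md PA])
    also have "\<dots> = (\<integral>\<^sup>+x. (\<Prod>i<N. indicator (A i) (x i) * indicator {0<..} (x i)) \<partial>V)"
    proof (rule nn_integral_cong)
      fix x assume "x \<in> space V"
      then have "indicator (Pi\<^sub>E {..<N} A) x = (\<Prod>i<N. indicator (A i) (x i) :: ennreal)"
        by (subst prod_indicator_Pi) (auto simp: V_def space_PiM PiE_iff split: split_indicator)
      then show "(\<Prod>i<N. indicator {0<..} (x i)) * indicator (Pi\<^sub>E {..<N} A) x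
        = (\<Prod>i<N. indicator (A i) (x i) * indicator {0<..} (x i) :: ennreal)"
        by (simp add: prod.distrib mult_ac)
    qed
    also have "\<dots> = (\<Prod>i<N. \<integral>\<^sup>+x. indicator (A i) x * indicator {0<..} x \<partial>lborel)"
      unfolding V_def using A by (intro L.product_nn_integral_prod) (auto intro!: borel_measurable_times_ennreal)
    also have "\<dots> = (\<Prod>i<N. emeasure \<mu> (A i))"
      by (rule prod.cong[OF refl]) (simp add: em A)
    finally show "emeasure ?R (Pi\<^sub>E {..<N} A) = (\<Prod>i<N. emeasure \<mu> (A i))" .
  qed (simp_all add: setsPi)
  ultimately show ?thesis by simp
qed





text \<open>The pushforward identity read as a change of variables. The nonnegative version serves
  to prove integrability, the Bochner version to deform an integral that is then differentiated in
  the deformation parameter.\<close>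

lemma
  fixes f f' :: "real \<Rightarrow> real" and N :: nat
  assumes df: "\<And>x. 0 \<le> x \<Longrightarrow> (f has_real_derivative f' x) (at x)"
    and cf: "continuous_on {0..} f'"
    and f'0: "\<And>x. 0 \<le> x \<Longrightarrow> 0 \<le> f' x"
    and f0: "f 0 = 0" and ftop: "filterlim f at_top at_top"
    and f'm[measurable]: "f' \<in> borel_measurable borel"
    and fm[measurable]: "f \<in> borel_measurable borel"
  defines "V \<equiv> (\<Pi>\<^sub>M i\<in>{..<N}. lborel :: real measure)"
  shows nn_integral_orthant_substitution:
      "h \<in> borel_measurable V \<Longrightarrow>
        (\<integral>\<^sup>+x. (\<Prod>i<N. indicator {0<..} (x i)) * h x \<partial>V)
          = (\<integral>\<^sup>+x. ennreal (\<Prod>i<N. f' (x i) * indicator {0<..} (x i)) * h (\<lambda>i\<in>{..<N}. f (x i)) \<partial>V)"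
    and integral_orthant_substitution:
      "g \<in> borel_measurable V \<Longrightarrow>
        (\<integral>x. (\<Prod>i<N. indicator {0<..} (x i)) * g x \<partial>V)
          = (\<integral>x. (\<Prod>i<N. f' (x i) * indicator {0<..} (x i)) * g (\<lambda>i\<in>{..<N}. f (x i)) \<partial>V :: real)"
proof -
  let ?T = "\<lambda>x. \<lambda>i\<in>{..<N}. f (x i)"
  let ?J = "\<lambda>x. \<Prod>i<N. f' (x i) * indicator {0<..} (x i)"
  let ?I = "\<lambda>x. \<Prod>i<N. indicator {0<..} (x i) :: real"
  have nn: "0 \<le> f' y * indicator {0<..} y" for y by (auto simp: f'0 split: split_indicator)
  have J: "(\<Prod>i<N. ennreal (f' (x i)) * indicator {0<..} (x i)) = ennreal (?J x)" for x
    by (subst prod_ennreal[symmetric]) (auto simp: nn intro!: prod.cong split: split_indicator)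
  have I: "(\<Prod>i<N. indicator {0<..} (x i)) = ennreal (?I x)" for x :: "nat \<Rightarrow> real"
    by (subst prod_ennreal[symmetric]) (auto simp: ennreal_indicator)
  have mf[measurable]: "?T \<in> measurable V V" unfolding V_def by measurable
  have mJ[measurable]: "?J \<in> borel_measurable V" unfolding V_def by measurable
  have mI[measurable]: "?I \<in> borel_measurable V" unfolding V_def by measurable
  have eq: "distr (density V (\<lambda>x. ennreal (?J x))) V ?T = density V (\<lambda>x. ennreal (?I x))"
    using distr_density_orthant[OF df cf f'0 f0 ftop f'm fm, of N] unfolding V_def J I .
  {
    assume [measurable]: "h \<in> borel_measurable V"
    have "(\<integral>\<^sup>+x. ennreal (?I x) * h x \<partial>V) = (\<integral>\<^sup>+x. h x \<partial>density V (\<lambda>x. ennreal (?I x)))"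
      by (subst nn_integral_density) auto
    also have "\<dots> = (\<integral>\<^sup>+x. h (?T x) \<partial>density V (\<lambda>x. ennreal (?J x)))"
      unfolding eq[symmetric] by (subst nn_integral_distr) auto
    also have "\<dots> = (\<integral>\<^sup>+x. ennreal (?J x) * h (?T x) \<partial>V)"
      by (subst nn_integral_density) auto
    finally show "(\<integral>\<^sup>+x. (\<Prod>i<N. indicator {0<..} (x i)) * h x \<partial>V)
          = (\<integral>\<^sup>+x. ennreal (\<Prod>i<N. f' (x i) * indicator {0<..} (x i)) * h (\<lambda>i\<in>{..<N}. f (x i)) \<partial>V)"
      by (simp only: I)
  next
    assume [measurable]: "g \<in> borel_measurable V"
    have "(\<integral>x. ?I x * g x \<partial>V) = (\<integral>x. g x \<partial>density V (\<lambda>x. ennreal (?I x)))"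
      by (subst integral_density) (auto intro!: prod_nonneg)
    also have "\<dots> = (\<integral>x. g (?T x) \<partial>density V (\<lambda>x. ennreal (?J x)))"
      unfolding eq[symmetric] by (subst integral_distr) auto
    also have "\<dots> = (\<integral>x. ?J x * g (?T x) \<partial>V)"
      by (subst integral_density) (auto intro!: prod_nonneg nn)
    finally show "(\<integral>x. (\<Prod>i<N. indicator {0<..} (x i)) * g x \<partial>V)
          = (\<integral>x. (\<Prod>i<N. f' (x i) * indicator {0<..} (x i)) * g (\<lambda>i\<in>{..<N}. f (x i)) \<partial>V :: real)" .
  }
qed

section \<open>Polynomially bounded functions against the Laguerre weight\<close>

abbreviation lebesgue_pow :: "nat \<Rightarrow> (nat \<Rightarrow> real) measure" where
  "lebesgue_pow N \<equiv> \<Pi>\<^sub>M i\<in>{..<N}. lborel"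

lemma laguerre_weight_nonneg: "0 \<le> laguerre_weight a \<beta> N x"
  unfolding laguerre_weight_def by (auto intro!: prod_nonneg mult_nonneg_nonneg)

lemma laguerre_weight_measurable [measurable]:
  "laguerre_weight a \<beta> N \<in> borel_measurable (lebesgue_pow N)"
proof -
  have [measurable]: "(\<lambda>x. \<Prod>k<N. \<Prod>j<k. \<bar>x k - x j\<bar> powr \<beta>) \<in> borel_measurable (lebesgue_pow N)"
  proof (intro borel_measurable_prod)
    fix k j assume "k \<in> {..<N}" "j \<in> {..<k}"
    then have [measurable]: "k \<in> {..<N}" "j \<in> {..<N}" by auto
    show "(\<lambda>x. \<bar>x k - x j\<bar> powr \<beta>) \<in> borel_measurable (lebesgue_pow N)" by measurable
  qed
  show ?thesis
    unfolding laguerre_weight_def by measurable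
qed

text \<open>Every factor of the weight responds multiplicatively: \<open>u l\<close> stretches
  coordinate \<open>l\<close>, and \<open>v k j\<close> is the resulting factor of the gap between
  \<open>k\<close> and \<open>j\<close>. It is used with \<open>u\<close> constantly
  \<open>1/2\<close> and with \<open>u l = 1 + t * x l ^ p\<close>.\<close>

lemma laguerre_weight_transform:
  assumes x: "\<And>l. l < N \<Longrightarrow> 0 < x l" and u: "\<And>l. l < N \<Longrightarrow> 0 < u l"
    and v: "\<And>j k. j < k \<Longrightarrow> k < N \<Longrightarrow> \<bar>x k * u k - x j * u j\<bar> = \<bar>x k - x j\<bar> * v k j"
    and v0: "\<And>j k. j < k \<Longrightarrow> k < N \<Longrightarrow> 0 \<le> v k j"
  shows "laguerre_weight a \<beta> N (\<lambda>i\<in>{..<N}. x i * u i) =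
    laguerre_weight a \<beta> N x * ((\<Prod>l<N. u l powr a * exp (x l - x l * u l)) * (\<Prod>k<N. \<Prod>j<k. v k j powr \<beta>))"
proof -
  have 1: "(x l * u l) powr a * exp (- (x l * u l))
      = (x l powr a * exp (- x l)) * (u l powr a * exp (x l - x l * u l))" if "l < N" for l
    using x[OF that] u[OF that] by (simp add: powr_mult mult_ac flip: exp_add)
  have 2: "\<bar>x k * u k - x j * u j\<bar> powr \<beta> = \<bar>x k - x j\<bar> powr \<beta> * v k j powr \<beta>" if "j < k" "k < N" for j k
    using v0[OF that] by (simp add: v[OF that] powr_mult)
  have "laguerre_weight a \<beta> N (\<lambda>i\<in>{..<N}. x i * u i) =
     (\<Prod>l<N. (x l * u l) powr a * exp (- (x l * u l))) *
     (\<Prod>k<N. \<Prod>j<k. \<bar>x k * u k - x j * u j\<bar> powr \<beta>)"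
  proof -
    have "\<forall>l<N. 0 < (\<lambda>i\<in>{..<N}. x i * u i) l" using x u by simp
    then show ?thesis
      unfolding laguerre_weight_def if_P[OF \<open>\<forall>l<N. 0 < (\<lambda>i\<in>{..<N}. x i * u i) l\<close>]
      by (simp cong: prod.cong_simp)
  qed
  also have "\<dots> = (\<Prod>l<N. (x l powr a * exp (- x l)) * (u l powr a * exp (x l - x l * u l))) *
     (\<Prod>k<N. \<Prod>j<k. \<bar>x k - x j\<bar> powr \<beta> * v k j powr \<beta>)"
    by (simp add: 1 2 cong: prod.cong_simp)
  also have "\<dots> = laguerre_weight a \<beta> N x * ((\<Prod>l<N. u l powr a * exp (x l - x l * u l)) * (\<Prod>k<N. \<Prod>j<k. v k j powr \<beta>))"
    using x by (simp add: laguerre_weight_def prod.distrib mult_ac)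
  finally show ?thesis .
qed

text \<open>The \<open>m\<close>-th power of \<open>1 + y \<le> exp y\<close> at
  \<open>y = s / (2 * m)\<close>, with \<open>M = (2 * m) ^ m\<close>.\<close>

lemma one_plus_power_le_exp:
  "\<exists>M. \<forall>s\<ge>0. (1 + s) ^ m \<le> M * exp (s / 2 :: real)"
proof (cases m)
  case 0
  then show ?thesis by (intro exI[of _ 1]) auto
next
  case (Suc m')
  have "(1 + s) ^ m \<le> (2 * real m) ^ m * exp (s / 2)" if "0 \<le> s" for s :: real
  proof -
    have "1 + s \<le> 2 * real m * (1 + s / (2 * real m))"
      using Suc by (simp add: field_simps)
    also have "\<dots> \<le> 2 * real m * exp (s / (2 * real m))"
      by (intro mult_left_mono exp_ge_add_one_self) auto
    finally have "(1 + s) ^ m \<le> (2 * real m * exp (s / (2 * real m))) ^ m"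
      using that by (intro power_mono) auto
    also have "\<dots> = (2 * real m) ^ m * exp (s / 2)"
      using Suc by (simp add: power_mult_distrib exp_of_nat_mult[symmetric] del: of_nat_Suc power_Suc)
    finally show ?thesis .
  qed
  then show ?thesis by blast
qed

text \<open>The bound is asked for only on the open orthant, outside which the weight vanishes. A
  single power of \<open>1 + (\<Sum>l<N. x l)\<close> dominates all monomials there, which makes
  closure under sums and products immediate.\<close>

definition poly_bounded :: "nat \<Rightarrow> ((nat \<Rightarrow> real) \<Rightarrow> real) \<Rightarrow> bool" where
  "poly_bounded N g \<longleftrightarrow> g \<in> borel_measurable (lebesgue_pow N) \<and>
     (\<exists>K m. \<forall>x. (\<forall>l<N. 0 < x l) \<longrightarrow> \<bar>g x\<bar> \<le> K * (1 + (\<Sum>l<N. x l)) ^ m)"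

lemma poly_boundedE:
  assumes "poly_bounded N g"
  obtains K m where "0 \<le> K"
    "\<And>x. (\<forall>l<N. 0 < x l) \<Longrightarrow> \<bar>g x\<bar> \<le> K * (1 + (\<Sum>l<N. x l)) ^ m"
proof -
  obtain K m where *: "\<And>x. (\<forall>l<N. 0 < x l) \<Longrightarrow> \<bar>g x\<bar> \<le> K * (1 + (\<Sum>l<N. x l)) ^ m"
    using assms unfolding poly_bounded_def by blast
  \<comment> \<open>The sign of \<open>K\<close> is read off at the point with all coordinates
    \<open>1\<close>.\<close>
  have "0 \<le> K * (1 + real N) ^ m"
    using *[of "\<lambda>_. 1"] by simp
  then have "0 \<le> K"
    by (simp add: zero_le_mult_iff) (smt (verit) of_nat_0_le_iff zero_less_power)
  with * that show ?thesis by blast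
qed

lemma poly_bounded_measurable: "poly_bounded N g \<Longrightarrow> g \<in> borel_measurable (lebesgue_pow N)"
  by (simp add: poly_bounded_def)

lemma poly_bounded_mult [intro]:
  assumes g: "poly_bounded N g" and h: "poly_bounded N h"
  shows "poly_bounded N (\<lambda>x. g x * h x)"
proof -
  obtain K m where K: "0 \<le> K" "\<And>x. (\<forall>l<N. 0 < x l) \<Longrightarrow> \<bar>g x\<bar> \<le> K * (1 + (\<Sum>l<N. x l)) ^ m"
    using poly_boundedE[OF g] by blast
  obtain L n where L: "0 \<le> L" "\<And>x. (\<forall>l<N. 0 < x l) \<Longrightarrow> \<bar>h x\<bar> \<le> L * (1 + (\<Sum>l<N. x l)) ^ n"
    using poly_boundedE[OF h] by blast
  have "\<bar>g x * h x\<bar> \<le> (K * L) * (1 + (\<Sum>l<N. x l)) ^ (m + n)" if "\<forall>l<N. 0 < x l" for x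
  proof -
    have "0 \<le> (\<Sum>l<N. x l)" using that by (intro sum_nonneg) (simp add: less_imp_le)
    then have "\<bar>g x\<bar> * \<bar>h x\<bar> \<le> (K * (1 + (\<Sum>l<N. x l)) ^ m) * (L * (1 + (\<Sum>l<N. x l)) ^ n)"
      using that K L by (intro mult_mono) auto
    then show ?thesis by (simp add: abs_mult power_add mult_ac)
  qed
  then show ?thesis
    unfolding poly_bounded_def using g h
    by (auto simp: poly_bounded_def intro!: borel_measurable_times exI[of _ "K * L"] exI[of _ "m + n"])
qed

lemma poly_bounded_add [intro]:
  assumes g: "poly_bounded N g" and h: "poly_bounded N h"
  shows "poly_bounded N (\<lambda>x. g x + h x)"
proof -
  obtain K m where K: "0 \<le> K" "\<And>x. (\<forall>l<N. 0 < x l) \<Longrightarrow> \<bar>g x\<bar> \<le> K * (1 + (\<Sum>l<N. x l)) ^ m"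
    using poly_boundedE[OF g] by blast
  obtain L n where L: "0 \<le> L" "\<And>x. (\<forall>l<N. 0 < x l) \<Longrightarrow> \<bar>h x\<bar> \<le> L * (1 + (\<Sum>l<N. x l)) ^ n"
    using poly_boundedE[OF h] by blast
  have "\<bar>g x + h x\<bar> \<le> (K + L) * (1 + (\<Sum>l<N. x l)) ^ (m + n)" if "\<forall>l<N. 0 < x l" for x
  proof -
    let ?s = "1 + (\<Sum>l<N. x l)"
    have "0 \<le> (\<Sum>l<N. x l)" using that by (intro sum_nonneg) (simp add: less_imp_le)
    then have "1 \<le> ?s" by simp
    then have "K * ?s ^ m \<le> K * ?s ^ (m + n)" "L * ?s ^ n \<le> L * ?s ^ (m + n)"
      using K L by (auto intro!: mult_left_mono power_increasing)
    then show ?thesis using K(2)[OF that] L(2)[OF that] by (simp add: algebra_simps)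
  qed
  then show ?thesis
    unfolding poly_bounded_def using g h
    by (auto simp: poly_bounded_def intro!: borel_measurable_add exI[of _ "K + L"] exI[of _ "m + n"])
qed

lemma poly_bounded_const [intro, simp]: "poly_bounded N (\<lambda>x. c)"
  unfolding poly_bounded_def by (intro conjI exI[of _ "\<bar>c\<bar>"] exI[of _ 0]) auto

lemma poly_bounded_component [intro]:
  assumes "i < N" shows "poly_bounded N (\<lambda>x. x i)"
  unfolding poly_bounded_def
proof (intro conjI exI[of _ 1] allI impI)
  have [measurable]: "i \<in> {..<N}" using assms by simp
  show "(\<lambda>x. x i) \<in> borel_measurable (lebesgue_pow N)" by measurable
  fix x :: "nat \<Rightarrow> real" assume x: "\<forall>l<N. 0 < x l"
  have "x i \<le> (\<Sum>l<N. x l)" using x assms by (intro member_le_sum) (auto simp: less_imp_le)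
  then show "\<bar>x i\<bar> \<le> 1 * (1 + (\<Sum>l<N. x l)) ^ 1" using x assms by (simp add: abs_of_pos)
qed

lemma poly_bounded_sum [intro]:
  "(\<And>i. i \<in> I \<Longrightarrow> poly_bounded N (g i)) \<Longrightarrow> poly_bounded N (\<lambda>x. \<Sum>i\<in>I. g i x)"
  by (induction I rule: infinite_finite_induct) auto

lemma poly_bounded_power [intro]:
  "poly_bounded N g \<Longrightarrow> poly_bounded N (\<lambda>x. g x ^ k)"
  by (induction k) auto

lemma poly_bounded_minus [intro]: "poly_bounded N g \<Longrightarrow> poly_bounded N (\<lambda>x. - g x)"
  using poly_bounded_mult[OF poly_bounded_const[of N "-1"], of g] by simp

lemmas poly_bounded_intros = poly_bounded_const poly_bounded_component poly_bounded_add
  poly_bounded_minus poly_bounded_mult poly_bounded_sum poly_bounded_power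

text \<open>Halving all coordinates turns integrability of the weight into integrability of the weight
  times \<open>exp (\<Sum> x / 2)\<close>, which dominates every polynomial.\<close>

lemma integrable_poly_bounded_laguerre_weight:
  assumes w: "integrable (lebesgue_pow N) (laguerre_weight a \<beta> N)" and g: "poly_bounded N g"
  shows "integrable (lebesgue_pow N) (\<lambda>x. g x * laguerre_weight a \<beta> N x)"
proof -
  let ?V = "lebesgue_pow N" and ?w = "laguerre_weight a \<beta> N"
  \<comment> \<open>Jacobian of the halving map times the factors it takes out of the powers and the
    gaps. The exponential is treated apart: \<open>exp (- x / 2)\<close> is
    \<open>exp (- x) * exp (x / 2)\<close>.\<close>
  define c where "c = (1/2) ^ N * ((\<Prod>l<N. (1/2) powr a) * (\<Prod>k<N. \<Prod>j<k. (1/2) powr \<beta>))"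
  have c: "0 < c" unfolding c_def by (intro mult_pos_pos prod_pos) auto
  note [measurable] = poly_bounded_measurable[OF g]
  have half: "(\<Prod>l<N. (1/2) * indicator {0<..} (x l)) * ?w (\<lambda>i\<in>{..<N}. x i * (1/2))
      = c * (exp ((\<Sum>l<N. x l) / 2) * ?w x)" for x
  proof (cases "\<forall>l<N. 0 < x l")
    case True
    have "?w (\<lambda>i\<in>{..<N}. x i * (1/2)) = ?w x * ((\<Prod>l<N. (1/2) powr a * exp (x l - x l * (1/2)))
        * (\<Prod>k<N. \<Prod>j<k. (1/2) powr \<beta>))"
      using True by (intro laguerre_weight_transform) (auto simp: field_simps abs_if)
    moreover have "(\<Prod>l<N. (1/2) powr a * exp (x l - x l * (1/2)))
        = (\<Prod>l<N. (1/2) powr a) * exp ((\<Sum>l<N. x l) / 2)"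
      by (simp add: prod.distrib exp_sum sum_divide_distrib)
    moreover have "(\<Prod>l<N. (1/2) * indicator {0<..} (x l)) = (1/2 :: real) ^ N"
      using True by simp
    ultimately show ?thesis by (simp add: c_def)
  next
    case False
    then show ?thesis by (auto simp: laguerre_weight_def)
  qed
  have filt: "filterlim (\<lambda>x::real. x / 2) at_top at_top"
    by real_asymp
  have "(\<integral>\<^sup>+x. (\<Prod>i<N. indicator {0<..} (x i)) * ennreal (?w x) \<partial>?V)
     = (\<integral>\<^sup>+x. ennreal (\<Prod>l<N. (1/2) * indicator {0<..} (x l)) * ennreal (?w (\<lambda>i\<in>{..<N}. x i * (1/2))) \<partial>?V)"
    by (rule nn_integral_orthant_substitution[where f="\<lambda>x. x * (1/2)" and f'="\<lambda>_. 1/2"])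
       (auto intro!: derivative_eq_intros filt)
  also have "\<dots> = (\<integral>\<^sup>+x. ennreal (c * (exp ((\<Sum>l<N. x l) / 2) * ?w x)) \<partial>?V)"
    by (subst half[symmetric]) (simp add: ennreal_mult prod_nonneg laguerre_weight_nonneg)
  finally have eq: "(\<integral>\<^sup>+x. ennreal (c * (exp ((\<Sum>l<N. x l) / 2) * ?w x)) \<partial>?V)
     = (\<integral>\<^sup>+x. (\<Prod>i<N. indicator {0<..} (x i)) * ennreal (?w x) \<partial>?V)" ..
  also have "\<dots> \<le> (\<integral>\<^sup>+x. ennreal (?w x) \<partial>?V)"
  proof (rule nn_integral_mono)
    fix x :: "nat \<Rightarrow> real"
    have "(\<Prod>i<N. indicator {0<..} (x i)) \<le> (1::ennreal)"
      by (subst prod_indicator_Pi) auto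
    then show "(\<Prod>i<N. indicator {0<..} (x i)) * ennreal (?w x) \<le> ennreal (?w x)"
      using mult_right_mono[of _ 1 "ennreal (?w x)"] by simp
  qed
  also have "\<dots> < \<infinity>"
    using w by (simp add: integrable_iff_bounded laguerre_weight_nonneg)
  finally have fin: "(\<integral>\<^sup>+x. ennreal (c * (exp ((\<Sum>l<N. x l) / 2) * ?w x)) \<partial>?V) < \<infinity>" .
  have int: "integrable ?V (\<lambda>x. c * (exp ((\<Sum>l<N. x l) / 2) * ?w x))"
  proof (rule integrableI_bounded)
    show "(\<lambda>x. c * (exp ((\<Sum>l<N. x l) / 2) * ?w x)) \<in> borel_measurable ?V" by measurable
    show "(\<integral>\<^sup>+x. ennreal (norm (c * (exp ((\<Sum>l<N. x l) / 2) * ?w x))) \<partial>?V) < \<infinity>"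
      using fin c by (simp add: laguerre_weight_nonneg abs_mult)
  qed
  obtain K m where K: "0 \<le> K" "\<And>x. (\<forall>l<N. 0 < x l) \<Longrightarrow> \<bar>g x\<bar> \<le> K * (1 + (\<Sum>l<N. x l)) ^ m"
    using poly_boundedE[OF g] by blast
  obtain M where M: "\<And>s. 0 \<le> s \<Longrightarrow> (1 + s) ^ m \<le> M * exp (s / 2 :: real)"
    using one_plus_power_le_exp by blast
  have int2: "integrable ?V (\<lambda>x. (K * M / c) * (c * (exp ((\<Sum>l<N. x l) / 2) * ?w x)))"
    using int by (rule integrable_mult_right)
  show ?thesis
  proof (rule Bochner_Integration.integrable_bound[OF int2])
    show "(\<lambda>x. g x * ?w x) \<in> borel_measurable ?V" by measurable
    have "\<bar>g x * ?w x\<bar> \<le> (K * M / c) * (c * (exp ((\<Sum>l<N. x l) / 2) * ?w x))" for x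
    proof (cases "\<forall>l<N. 0 < x l")
      case True
      have "0 \<le> (\<Sum>l<N. x l)" using True by (intro sum_nonneg) (simp add: less_imp_le)
      then have "\<bar>g x\<bar> \<le> K * (M * exp ((\<Sum>l<N. x l) / 2))"
        by (intro order_trans[OF K(2)[OF True]] mult_left_mono M K(1))
      then have "\<bar>g x\<bar> * ?w x \<le> K * (M * exp ((\<Sum>l<N. x l) / 2)) * ?w x"
        by (rule mult_right_mono) (rule laguerre_weight_nonneg)
      then show ?thesis using c by (simp add: abs_mult laguerre_weight_nonneg mult_ac)
    next
      case False
      then show ?thesis by (auto simp: laguerre_weight_def)
    qed
    then show "AE x in ?V. norm (g x * ?w x) \<le> norm ((K * M / c) * (c * (exp ((\<Sum>l<N. x l) / 2) * ?w x)))"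
      by (intro AE_I2) (smt (verit) real_norm_def)
  qed
qed

section \<open>Germs at \<open>t = 0\<close> and differentiation under the integral sign\<close>

text \<open>Factors equal to \<open>1\<close> at \<open>t = 0\<close>, with right derivative \<open>d\<close> there. The bound is linear in \<open>t\<close> so
  that difference quotients are dominated and the notion is closed under products.\<close>

definition unit_germ :: "nat \<Rightarrow> (real \<Rightarrow> (nat \<Rightarrow> real) \<Rightarrow> real) \<Rightarrow> ((nat \<Rightarrow> real) \<Rightarrow> real) \<Rightarrow> bool" where
  "unit_germ N g d \<longleftrightarrow> (\<forall>t. g t \<in> borel_measurable (lebesgue_pow N)) \<and> poly_bounded N d \<and>
     (\<exists>B. poly_bounded N B \<and>
        (\<forall>x. (\<forall>l<N. 0 < x l) \<longrightarrow> (\<forall>t\<in>{0<..1}. \<bar>g t x - 1\<bar> \<le> t * B x))) \<and>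
     (\<forall>x. (\<forall>l<N. 0 < x l) \<longrightarrow> ((\<lambda>t. (g t x - 1) / t) \<longlongrightarrow> d x) (at_right 0))"

lemma unit_germ_tendsto_one:
  assumes "((\<lambda>t. (g t - 1) / t) \<longlongrightarrow> d) (at_right (0::real))"
  shows "((\<lambda>t. g t - 1) \<longlongrightarrow> (0::real)) (at_right 0)"
proof -
  have "((\<lambda>t. (g t - 1) / t * t) \<longlongrightarrow> d * 0) (at_right 0)"
    by (intro tendsto_mult assms tendsto_ident_at)
  moreover have "eventually (\<lambda>t. (g t - 1) / t * t = g t - 1) (at_right (0::real))"
    by (auto simp: eventually_at_right_field intro: exI[of _ 1])
  ultimately show ?thesis
    by (simp add: tendsto_cong)
qed

text \<open>Product rule, from \<open>g h - 1 = (g - 1) (h - 1) + (g - 1) + (h - 1)\<close>. The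
  first term is of order \<open>t ^ 2\<close>: it does not contribute to the derivative, and
  \<open>t \<le> 1\<close> keeps the bound linear in \<open>t\<close>.\<close>

lemma unit_germ_mult:
  assumes g: "unit_germ N g d" and h: "unit_germ N h e"
  shows "unit_germ N (\<lambda>t x. g t x * h t x) (\<lambda>x. d x + e x)"
proof -
  obtain B where B: "poly_bounded N B"
    "\<And>x t. (\<forall>l<N. 0 < x l) \<Longrightarrow> t \<in> {0<..1} \<Longrightarrow> \<bar>g t x - 1\<bar> \<le> t * B x"
    using g unfolding unit_germ_def by blast
  obtain C where C: "poly_bounded N C"
    "\<And>x t. (\<forall>l<N. 0 < x l) \<Longrightarrow> t \<in> {0<..1} \<Longrightarrow> \<bar>h t x - 1\<bar> \<le> t * C x"
    using h unfolding unit_germ_def by blast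
  have split: "g t x * h t x - 1 = (g t x - 1) * (h t x - 1) + (g t x - 1) + (h t x - 1)" for t x
    by (simp add: algebra_simps)
  have "\<bar>g t x * h t x - 1\<bar> \<le> t * (B x * C x + B x + C x)"
    if x: "\<forall>l<N. 0 < x l" and t: "t \<in> {0<..1}" for x t
  proof -
    have b: "\<bar>g t x - 1\<bar> \<le> t * B x" and c: "\<bar>h t x - 1\<bar> \<le> t * C x" using B C x t by auto
    have "0 \<le> t * C x" using c by linarith
    then have C0: "0 \<le> C x" using t by (simp add: zero_le_mult_iff)
    have "0 \<le> t * B x" using b by linarith
    have "\<bar>(g t x - 1) * (h t x - 1)\<bar> \<le> (t * B x) * (t * C x)"
      using b c \<open>0 \<le> t * B x\<close> by (simp add: abs_mult mult_mono)
    also have "\<dots> \<le> (t * B x) * (1 * C x)"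
      using t C0 \<open>0 \<le> t * B x\<close> by (intro mult_left_mono mult_right_mono) auto
    finally show ?thesis unfolding split using b c by (simp add: algebra_simps)
  qed
  moreover have "((\<lambda>t. (g t x * h t x - 1) / t) \<longlongrightarrow> d x + e x) (at_right 0)"
    if x: "\<forall>l<N. 0 < x l" for x
  proof -
    have dg: "((\<lambda>t. (g t x - 1) / t) \<longlongrightarrow> d x) (at_right 0)"
      and eh: "((\<lambda>t. (h t x - 1) / t) \<longlongrightarrow> e x) (at_right 0)"
      using g h x unfolding unit_germ_def by auto
    have "((\<lambda>t. (g t x - 1) / t * (h t x - 1) + (g t x - 1) / t + (h t x - 1) / t)
        \<longlongrightarrow> d x * 0 + d x + e x) (at_right 0)"
      by (intro tendsto_add tendsto_mult dg eh unit_germ_tendsto_one[OF eh])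
    then show ?thesis
      unfolding split by (simp only: add_divide_distrib times_divide_eq_left mult_zero_right add_0)
  qed
  moreover have "poly_bounded N (\<lambda>x. B x * C x + B x + C x)" by (intro poly_bounded_intros B C)
  ultimately show ?thesis
    using g h unfolding unit_germ_def
    by (auto intro!: borel_measurable_times)
qed

lemma unit_germ_one: "unit_germ N (\<lambda>t x. 1) (\<lambda>x. 0)"
  unfolding unit_germ_def by (auto intro!: exI[of _ "\<lambda>x. 0"])

lemma unit_germ_prod:
  assumes "finite I" "\<And>i. i \<in> I \<Longrightarrow> unit_germ N (g i) (d i)"
  shows "unit_germ N (\<lambda>t x. \<Prod>i\<in>I. g i t x) (\<lambda>x. \<Sum>i\<in>I. d i x)"
  using assms by (induction I) (auto intro: unit_germ_one unit_germ_mult)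

text \<open>Mean value theorem for \<open>z powr b\<close> between \<open>1\<close> and
  \<open>1 + y\<close>. The slope is bounded through an integer power of \<open>1 + y\<close>, so a
  polynomially bounded \<open>y\<close> gives a polynomial bound;
  \<open>b - 1 \<le> \<bar>b\<bar>\<close> treats both signs of \<open>b\<close> at once.\<close>

lemma abs_one_plus_powr_minus_one_le:
  fixes y b :: real
  assumes y: "0 \<le> y"
  shows "\<bar>(1 + y) powr b - 1\<bar> \<le> y * (\<bar>b\<bar> * (1 + y) ^ nat \<lceil>\<bar>b\<bar>\<rceil>)"
proof (cases "y = 0")
  case False
  with y have y: "0 < y" by simp
  have "\<exists>z. 1 < z \<and> z < 1 + y \<and>
      (1 + y) powr b - 1 powr b = ((1 + y) - 1) * (b * z powr (b - 1))"
    by (rule MVT2) (use y in \<open>auto intro!: derivative_eq_intros\<close>)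
  then obtain z where z: "1 < z" "z < 1 + y" "(1 + y) powr b - 1 = y * (b * z powr (b - 1))"
    by auto
  have "z powr (b - 1) \<le> z powr \<bar>b\<bar>" using z by (intro powr_mono) auto
  also have "\<dots> \<le> (1 + y) powr \<bar>b\<bar>" using z by (intro powr_mono2) auto
  also have "\<dots> \<le> (1 + y) powr real (nat \<lceil>\<bar>b\<bar>\<rceil>)" using y by (intro powr_mono) linarith+
  also have "\<dots> = (1 + y) ^ nat \<lceil>\<bar>b\<bar>\<rceil>" using y by (subst powr_realpow) auto
  finally have "y * (\<bar>b\<bar> * z powr (b - 1)) \<le> y * (\<bar>b\<bar> * (1 + y) ^ nat \<lceil>\<bar>b\<bar>\<rceil>)"
    using y by (intro mult_left_mono) auto
  then show ?thesis using y by (simp add: z(3) abs_mult)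
qed auto

text \<open>This one shape covers the Jacobian (exponent \<open>1\<close>), the deformed summand
  \<open>x i ^ q\<close> (exponent \<open>q\<close>), the factor \<open>x l powr a\<close> and the
  gaps (exponent \<beta>).\<close>

lemma unit_germ_powr:
  assumes q: "poly_bounded N q" and q0: "\<And>x. (\<forall>l<N. 0 < x l) \<Longrightarrow> 0 \<le> q x"
  shows "unit_germ N (\<lambda>t x. (1 + t * q x) powr b) (\<lambda>x. b * q x)"
proof -
  note [measurable] = poly_bounded_measurable[OF q]
  let ?n = "nat \<lceil>\<bar>b\<bar>\<rceil>"
  have "\<bar>(1 + t * q x) powr b - 1\<bar> \<le> t * (q x * (\<bar>b\<bar> * (1 + q x) ^ ?n))"
    if x: "\<forall>l<N. 0 < x l" and t: "t \<in> {0<..1}" for x t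
  proof -
    have "0 \<le> q x" by (rule q0[OF x])
    moreover have "t * q x \<le> 1 * q x" using t \<open>0 \<le> q x\<close> by (intro mult_right_mono) auto
    ultimately have "(t * q x) * (\<bar>b\<bar> * (1 + t * q x) ^ ?n) \<le> (t * q x) * (\<bar>b\<bar> * (1 + q x) ^ ?n)"
      using t by (intro mult_left_mono power_mono) auto
    moreover have "\<bar>(1 + t * q x) powr b - 1\<bar> \<le> (t * q x) * (\<bar>b\<bar> * (1 + t * q x) ^ ?n)"
      using t \<open>0 \<le> q x\<close> by (intro abs_one_plus_powr_minus_one_le) auto
    ultimately show ?thesis by (simp only: mult.assoc)
  qed
  moreover have "poly_bounded N (\<lambda>x. q x * (\<bar>b\<bar> * (1 + q x) ^ ?n))"
    by (intro poly_bounded_intros q)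
  moreover have "((\<lambda>t. ((1 + t * q x) powr b - 1) / t) \<longlongrightarrow> b * q x) (at_right 0)" for x
  proof -
    have "((\<lambda>t. (1 + t * q x) powr b) has_real_derivative b * q x) (at 0)"
      by (auto intro!: derivative_eq_intros)
    then show ?thesis
      by (auto simp: DERIV_def intro: filterlim_mono[OF _ order_refl at_le])
  qed
  moreover have "(\<lambda>x. (1 + t * q x) powr b) \<in> borel_measurable (lebesgue_pow N)" for t
    by measurable
  ultimately show ?thesis unfolding unit_germ_def
    using q poly_bounded_mult[OF poly_bounded_const q, of b] by blast
qed

lemma unit_germ_exp:
  assumes q: "poly_bounded N q" and q0: "\<And>x. (\<forall>l<N. 0 < x l) \<Longrightarrow> 0 \<le> q x"
  shows "unit_germ N (\<lambda>t x. exp (- (t * q x))) (\<lambda>x. - q x)"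
proof -
  note [measurable] = poly_bounded_measurable[OF q]
  have "\<bar>exp (- (t * q x)) - 1\<bar> \<le> t * q x"
    if x: "\<forall>l<N. 0 < x l" and t: "t \<in> {0<..1}" for x t
  proof -
    have "0 \<le> t * q x" using q0[OF x] t by simp
    then show ?thesis using exp_ge_add_one_self[of "- (t * q x)"] by (simp add: abs_if)
  qed
  moreover have "((\<lambda>t. (exp (- (t * q x)) - 1) / t) \<longlongrightarrow> - q x) (at_right 0)" for x
  proof -
    have "((\<lambda>t. exp (- (t * q x))) has_real_derivative - q x) (at 0)"
      by (auto intro!: derivative_eq_intros)
    then show ?thesis
      by (auto simp: DERIV_def intro: filterlim_mono[OF _ order_refl at_le])
  qed
  moreover have "(\<lambda>x. exp (- (t * q x))) \<in> borel_measurable (lebesgue_pow N)" for t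
    by measurable
  ultimately show ?thesis unfolding unit_germ_def
    using q poly_bounded_minus[OF q] by blast
qed

text \<open>An integral that is constant in \<open>t\<close> has vanishing difference quotients, and
  dominated convergence moves the limit inside. The sum over \<open>I\<close> is kept explicit
  because each term of the deformed power sum carries its own germ.\<close>

lemma unit_germ_integral_deriv:
  assumes w: "integrable (lebesgue_pow N) (laguerre_weight a \<beta> N)"
    and F: "\<And>i. i \<in> I \<Longrightarrow> poly_bounded N (F i)" and I: "finite I"
    and g: "\<And>i. i \<in> I \<Longrightarrow> unit_germ N (g i) (d i)"
    and const: "\<And>t. 0 < t \<Longrightarrow> (\<integral>x. (\<Sum>i\<in>I. F i x * g i t x) * laguerre_weight a \<beta> N x \<partial>lebesgue_pow N)
        = (\<integral>x. (\<Sum>i\<in>I. F i x) * laguerre_weight a \<beta> N x \<partial>lebesgue_pow N)"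
  shows "(\<integral>x. (\<Sum>i\<in>I. F i x * d i x) * laguerre_weight a \<beta> N x \<partial>lebesgue_pow N) = 0"
proof -
  let ?V = "lebesgue_pow N" and ?w = "laguerre_weight a \<beta> N"
  have "\<forall>i\<in>I. \<exists>B. poly_bounded N B \<and>
        (\<forall>x. (\<forall>l<N. 0 < x l) \<longrightarrow> (\<forall>t\<in>{0<..1}. \<bar>g i t x - 1\<bar> \<le> t * B x))"
    using g unfolding unit_germ_def by blast
  then obtain B where B: "\<And>i. i \<in> I \<Longrightarrow> poly_bounded N (B i)"
    and Bb: "\<And>i x t. i \<in> I \<Longrightarrow> (\<forall>l<N. 0 < x l) \<Longrightarrow> t \<in> {0<..1} \<Longrightarrow> \<bar>g i t x - 1\<bar> \<le> t * B i x"
    by metis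
  note Fm[measurable] = poly_bounded_measurable[OF F]
  have gm[measurable]: "\<And>i t. i \<in> I \<Longrightarrow> g i t \<in> borel_measurable ?V"
    and dp: "\<And>i. i \<in> I \<Longrightarrow> poly_bounded N (d i)"
    using g unfolding unit_germ_def by auto
  note dm[measurable] = poly_bounded_measurable[OF dp]
  have lim: "((\<lambda>t. (g i t x - 1) / t) \<longlongrightarrow> d i x) (at_right 0)" if "i \<in> I" "\<forall>l<N. 0 < x l" for i x
    using g that unfolding unit_germ_def by blast
  \<comment> \<open>A sequence in \<open>(0, 1]\<close> tending to \<open>0\<close>, so that the
    germ bounds apply and dominated convergence can be used in its sequential form.\<close>
  define s where "s n = 1 / real (Suc n)" for n
  have s: "0 < s n" "s n \<le> 1" for n by (auto simp: s_def)
  have s0: "filterlim s (at_right 0) sequentially"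
    unfolding s_def filterlim_at
    by (intro conjI LIMSEQ_inverse_real_of_nat[unfolded inverse_eq_divide]) auto
  define u where "u n x = (\<Sum>i\<in>I. F i x * ((g i (s n) x - 1) / s n)) * ?w x" for n x
  \<comment> \<open>The dominating function comes from \<open>\<bar>F\<bar> \<le> F * F + 1\<close>;
    it contains no absolute value and is thus polynomially bounded by the closure rules.\<close>
  let ?B = "\<lambda>x. \<Sum>i\<in>I. F i x * F i x * B i x + B i x"
  have bound: "\<bar>u n x\<bar> \<le> ?B x * ?w x" for n x
  proof (cases "\<forall>l<N. 0 < x l")
    case True
    have "\<bar>F i x * ((g i (s n) x - 1) / s n)\<bar> \<le> F i x * F i x * B i x + B i x" if i: "i \<in> I" for i
    proof -
      have b: "\<bar>g i (s n) x - 1\<bar> \<le> s n * B i x" using Bb[OF i True] s by auto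
      then have q: "\<bar>(g i (s n) x - 1) / s n\<bar> \<le> B i x"
        using s[of n] by (simp add: field_simps)
      then have "\<bar>F i x * ((g i (s n) x - 1) / s n)\<bar> \<le> \<bar>F i x\<bar> * B i x"
        unfolding abs_mult by (intro mult_left_mono) auto
      also have "\<dots> \<le> (F i x * F i x + 1) * B i x"
      proof (rule mult_right_mono)
        have "0 \<le> (\<bar>F i x\<bar> - 1)\<^sup>2" by simp
        then show "\<bar>F i x\<bar> \<le> F i x * F i x + 1"
          by (simp add: power2_eq_square algebra_simps)
        show "0 \<le> B i x" using q by linarith
      qed
      finally show ?thesis by (simp add: algebra_simps)
    qed
    then have "\<bar>\<Sum>i\<in>I. F i x * ((g i (s n) x - 1) / s n)\<bar> \<le> ?B x"
      by (intro order_trans[OF sum_abs] sum_mono)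
    then show ?thesis
      unfolding u_def abs_mult by (simp add: laguerre_weight_nonneg mult_right_mono)
  next
    case False
    then show ?thesis by (auto simp: u_def laguerre_weight_def)
  qed
  have "(\<lambda>n. \<integral>x. u n x \<partial>?V) \<longlonglongrightarrow> (\<integral>x. (\<Sum>i\<in>I. F i x * d i x) * ?w x \<partial>?V)"
  proof (rule integral_dominated_convergence[where w="\<lambda>x. ?B x * ?w x"])
    show "(\<lambda>x. (\<Sum>i\<in>I. F i x * d i x) * ?w x) \<in> borel_measurable ?V" by measurable
    show "u n \<in> borel_measurable ?V" for n unfolding u_def by measurable
    show "integrable ?V (\<lambda>x. ?B x * ?w x)"
      by (rule integrable_poly_bounded_laguerre_weight[OF w]) (intro poly_bounded_sum poly_bounded_add poly_bounded_mult F B)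
    show "AE x in ?V. norm (u n x) \<le> ?B x * ?w x" for n using bound by (intro AE_I2) simp
    show "AE x in ?V. (\<lambda>n. u n x) \<longlonglongrightarrow> (\<Sum>i\<in>I. F i x * d i x) * ?w x"
    proof (rule AE_I2)
      fix x :: "nat \<Rightarrow> real"
      show "(\<lambda>n. u n x) \<longlonglongrightarrow> (\<Sum>i\<in>I. F i x * d i x) * ?w x"
      proof (cases "\<forall>l<N. 0 < x l")
        case True
        show ?thesis
          unfolding u_def
          by (intro tendsto_intros filterlim_compose[OF lim[OF _ True] s0])
      next
        case False
        then show ?thesis by (auto simp: u_def laguerre_weight_def)
      qed
    qed
  qed
  moreover have "(\<integral>x. u n x \<partial>?V) = 0" for n
  proof -
    have iF: "integrable ?V (\<lambda>x. (\<Sum>i\<in>I. F i x) * ?w x)"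
      by (rule integrable_poly_bounded_laguerre_weight[OF w]) (intro poly_bounded_sum F)
    have iu: "integrable ?V (u n)"
    proof (rule Bochner_Integration.integrable_bound)
      show "integrable ?V (\<lambda>x. ?B x * ?w x)"
        by (rule integrable_poly_bounded_laguerre_weight[OF w]) (intro poly_bounded_sum poly_bounded_add poly_bounded_mult F B)
      show "u n \<in> borel_measurable ?V" unfolding u_def by measurable
      show "AE x in ?V. norm (u n x) \<le> norm (?B x * ?w x)"
        using order_trans[OF bound abs_ge_self] by (intro AE_I2) simp
    qed
    \<comment> \<open>The deformed integrand is the undeformed one plus \<open>s n\<close> times the
      difference quotient; as the two integrals agree, the quotient integrates to
      \<open>0\<close>.\<close>
    have eq: "(\<Sum>i\<in>I. F i x * g i (s n) x) * ?w x = s n * u n x + (\<Sum>i\<in>I. F i x) * ?w x" for x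
    proof -
      have "(\<Sum>i\<in>I. F i x * g i (s n) x) = s n * (\<Sum>i\<in>I. F i x * ((g i (s n) x - 1) / s n)) + (\<Sum>i\<in>I. F i x)"
        unfolding sum_distrib_left sum.distrib[symmetric]
        using s(1)[of n] by (intro sum.cong refl) (simp add: field_simps)
      then show ?thesis by (simp add: u_def algebra_simps)
    qed
    have "(\<integral>x. (\<Sum>i\<in>I. F i x * g i (s n) x) * ?w x \<partial>?V)
        = s n * (\<integral>x. u n x \<partial>?V) + (\<integral>x. (\<Sum>i\<in>I. F i x) * ?w x \<partial>?V)"
      unfolding eq using iu iF by simp
    then show ?thesis using const[OF s(1), of n] s(1)[of n] by simp
  qed
  ultimately show ?thesis by (simp add: LIMSEQ_const_iff)
qed

section \<open>Loop equations\<close>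

lemma sum_symmetric_pairs:
  fixes S :: "nat \<Rightarrow> nat \<Rightarrow> real"
  assumes "\<And>j k. S j k = S k j"
  shows "(\<Sum>k<N. \<Sum>j<N. S k j) = 2 * (\<Sum>k<N. \<Sum>j<k. S k j) + (\<Sum>k<N. S k k)"
proof (induction N)
  case (Suc N)
  have "(\<Sum>k<N. S k N) = (\<Sum>j<N. S N j)" by (rule sum.cong) (auto intro: assms)
  then show ?case using Suc by (simp add: sum.distrib algebra_simps)
qed auto

text \<open>The inner sum is the divided difference of \<open>x ^ (p + 1)\<close> at
  \<open>x k\<close> and \<open>x j\<close>. It is symmetric, so the pairs \<open>j < k\<close> make
  up half of the full square minus its diagonal, where the value is
  \<open>(p + 1) * x k ^ p\<close>.\<close>

lemma sum_divided_differences: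
  "(\<Sum>k<N. \<Sum>j<k. \<Sum>r<Suc p. x k ^ r * x j ^ (p - r)) =
    ((\<Sum>r\<le>p. power_sum N r x * power_sum N (p - r) x) - (real p + 1) * power_sum N p x) / 2"
proof -
  define S where "S k j = (\<Sum>r<Suc p. x k ^ r * x j ^ (p - r))" for k j
  have sym: "S k j = S j k" for k j
    unfolding S_def
    by (subst sum.nat_diff_reindex[symmetric]) (auto intro!: sum.cong simp: mult_ac)
  have diag: "S k k = (real p + 1) * x k ^ p" for k
    unfolding S_def by (simp add: power_add[symmetric])
  have "(\<Sum>k<N. \<Sum>j<N. S k j) = (\<Sum>r<Suc p. \<Sum>k<N. \<Sum>j<N. x k ^ r * x j ^ (p - r))"
    unfolding S_def by (subst sum.swap, subst (2) sum.swap) (rule refl)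
  also have "\<dots> = (\<Sum>r\<le>p. power_sum N r x * power_sum N (p - r) x)"
    unfolding power_sum_def sum_product lessThan_Suc_atMost ..
  finally have "2 * (\<Sum>k<N. \<Sum>j<k. S k j) + (\<Sum>k<N. S k k) = (\<Sum>r\<le>p. power_sum N r x * power_sum N (p - r) x)"
    using sum_symmetric_pairs[of S N, OF sym] by simp
  moreover have "(\<Sum>k<N. S k k) = (real p + 1) * power_sum N p x"
    by (simp add: diag power_sum_def sum_distrib_left)
  ultimately show ?thesis
    unfolding S_def[symmetric] by simp
qed

text \<open>Covers a partition function equal to \<open>0\<close> as well: division by
  \<open>0\<close> then makes the density and both sides \<open>0\<close>.\<close>

lemma integral_laguerre_ensemble:
  assumes [measurable]: "h \<in> borel_measurable (lebesgue_pow N)"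
  shows "(\<integral>x. h x \<partial>laguerre_ensemble a \<beta> N) =
    (\<integral>x. h x * laguerre_weight a \<beta> N x \<partial>lebesgue_pow N) / laguerre_partition a \<beta> N"
proof -
  have "0 \<le> laguerre_partition a \<beta> N"
    unfolding laguerre_partition_def by (simp add: laguerre_weight_nonneg)
  then show ?thesis
    unfolding laguerre_ensemble_def
    by (subst integral_density) (auto simp: laguerre_weight_nonneg mult.commute)
qed

lemma poly_bounded_power_sum [intro]: "poly_bounded N (power_sum N p)"
  unfolding power_sum_def[abs_def]
  by (intro poly_bounded_sum poly_bounded_power poly_bounded_component) auto

text \<open>Substituting \<open>x + t * x ^ (p + 1)\<close> for every coordinate multiplies each difference \<open>x k - x j\<close> by
  \<open>1 + t * Q k j x\<close> with \<open>Q\<close> a nonnegative polynomial. So no singular term arises when \<open>\<beta> < 0\<close>, whereas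
  integration by parts would meet the non-integrable \<open>\<bar>x k - x j\<bar> powr (\<beta> - 1)\<close>.\<close>

lemma laguerre_integral_deformed:
  fixes p q N :: nat
  assumes t: "0 < t"
  defines "Q \<equiv> \<lambda>k j (x :: nat \<Rightarrow> real). \<Sum>r<Suc p. x k ^ r * x j ^ (p - r)"
  shows "(\<integral>x. (\<Sum>i<N. x i ^ q * ((1 + t * x i ^ p) powr real q *
        ((\<Prod>l<N. (1 + t * ((real p + 1) * x l ^ p)) powr 1 *
            ((1 + t * x l ^ p) powr a * exp (- (t * x l ^ (p + 1))))) *
         (\<Prod>k<N. \<Prod>j<k. (1 + t * Q k j x) powr \<beta>)))) * laguerre_weight a \<beta> N x \<partial>lebesgue_pow N)
     = (\<integral>x. (\<Sum>i<N. x i ^ q) * laguerre_weight a \<beta> N x \<partial>lebesgue_pow N)"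
    (is "(\<integral>x. ?H x * ?w x \<partial>?V) = _")
proof -
  let ?f = "\<lambda>x::real. x * (1 + t * x ^ p)" and ?f' = "\<lambda>x. 1 + t * ((real p + 1) * x ^ p)"
  let ?I = "\<lambda>x. \<Prod>i<N. indicator {0<..} (x i) :: real"
  let ?T = "\<lambda>x. \<lambda>i\<in>{..<N}. ?f (x i)"
  have filt: "filterlim ?f at_top at_top"
  proof (rule filterlim_at_top_mono[OF filterlim_ident])
    show "eventually (\<lambda>x. x \<le> ?f x) at_top"
      using eventually_ge_at_top[of 0] by eventually_elim (use t in \<open>simp add: algebra_simps\<close>)
  qed
  have deriv: "(?f has_real_derivative ?f' x) (at x)" for x
    by (rule derivative_eq_intros refl | (cases p; simp add: algebra_simps; fail))+
  have G[measurable]: "(\<lambda>x. (\<Sum>i<N. x i ^ q) * ?w x) \<in> borel_measurable ?V"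
    by measurable
  have "(\<integral>x. (\<Sum>i<N. x i ^ q) * ?w x \<partial>?V) = (\<integral>x. ?I x * ((\<Sum>i<N. x i ^ q) * ?w x) \<partial>?V)"
    by (intro Bochner_Integration.integral_cong refl) (auto simp: laguerre_weight_def prod_indicator_Pi)
  also have "\<dots> = (\<integral>x. (\<Prod>i<N. ?f' (x i) * indicator {0<..} (x i)) * ((\<Sum>i<N. ?T x i ^ q) * ?w (?T x)) \<partial>?V)"
    by (rule integral_orthant_substitution[OF deriv _ _ _ filt _ _ G])
       (use t in \<open>auto intro!: continuous_intros add_nonneg_nonneg mult_nonneg_nonneg\<close>)
  also have "\<dots> = (\<integral>x. ?H x * ?w x \<partial>?V)"
  proof (intro Bochner_Integration.integral_cong refl)
    fix x :: "nat \<Rightarrow> real"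
    show "(\<Prod>i<N. ?f' (x i) * indicator {0<..} (x i)) * ((\<Sum>i<N. ?T x i ^ q) * ?w (?T x)) = ?H x * ?w x"
    proof (cases "\<forall>l<N. 0 < x l")
      case True
      then have x: "0 < x l" if "l < N" for l using that by auto
      have u: "0 < 1 + t * x l ^ p" if "l < N" for l
        using x[OF that] t by (intro add_pos_nonneg) auto
      have u': "0 < 1 + t * ((real p + 1) * x l ^ p)" if "l < N" for l
        using x[OF that] t by (intro add_pos_nonneg) auto
      have Q0: "0 \<le> Q k j x" if "j < k" "k < N" for j k
        unfolding Q_def using x[of k] x[of j] that
        by (intro sum_nonneg mult_nonneg_nonneg zero_le_power) auto
      have diff: "\<bar>x k * (1 + t * x k ^ p) - x j * (1 + t * x j ^ p)\<bar> = \<bar>x k - x j\<bar> * (1 + t * Q k j x)"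
        if "j < k" "k < N" for j k
      proof -
        have "x k * (1 + t * x k ^ p) - x j * (1 + t * x j ^ p) = (x k - x j) + t * (x k ^ Suc p - x j ^ Suc p)"
          by (simp add: algebra_simps)
        also have "\<dots> = (x k - x j) * (1 + t * Q k j x)"
          unfolding diff_power_eq_sum Q_def by (simp only: algebra_simps)
        finally show ?thesis using Q0[OF that] t by (simp add: abs_mult)
      qed
      have w: "?w (?T x) = ?w x * ((\<Prod>l<N. (1 + t * x l ^ p) powr a * exp (x l - x l * (1 + t * x l ^ p)))
          * (\<Prod>k<N. \<Prod>j<k. (1 + t * Q k j x) powr \<beta>))"
        by (rule laguerre_weight_transform) (use x u diff Q0 t in auto)
      have e: "x l - x l * (1 + t * x l ^ p) = - (t * x l ^ (p + 1))" for l
        by (simp add: algebra_simps)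
      \<comment> \<open>The Jacobian is written with \<open>powr 1\<close>, and below the factor of
        \<open>x i ^ q\<close> with \<open>powr real q\<close>, to match the shape of
        \<open>unit_germ_powr\<close>.\<close>
      have J: "(\<Prod>i<N. ?f' (x i) * indicator {0<..} (x i)) = (\<Prod>l<N. (1 + t * ((real p + 1) * x l ^ p)) powr 1)"
        using x u' by (intro prod.cong refl) (simp add: less_imp_le)
      have S: "(\<Sum>i<N. ?T x i ^ q) = (\<Sum>i<N. x i ^ q * (1 + t * x i ^ p) powr real q)"
        using u by (intro sum.cong refl) (simp add: power_mult_distrib powr_realpow)
      show ?thesis
        unfolding w e J S
        by (simp add: prod.distrib sum_distrib_left sum_distrib_right mult_ac)
    next
      case False
      then obtain l where l: "l < N" "\<not> 0 < x l" by auto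
      then have "(\<Prod>i<N. ?f' (x i) * indicator {0<..} (x i)) = 0"
        by (intro prod_zero) (auto intro!: bexI[of _ l])
      moreover have "?w x = 0" using l by (auto simp: laguerre_weight_def)
      ultimately show ?thesis by simp
    qed
  qed
  finally show ?thesis ..
qed

text \<open>The derivative at \<open>t = 0\<close> of the deformed integral. In \<open>?d i\<close>
  the terms come, in order, from \<open>x i ^ q\<close>, the Jacobian, the power and the exponential
  in the weight, and the gaps.\<close>

lemma laguerre_loop_equation_weight:
  assumes w: "integrable (lebesgue_pow N) (laguerre_weight a \<beta> N)"
  defines "P \<equiv> power_sum N"
  shows "(\<integral>x. (real q * P (p + q) x + (real p + 1 + a) * (P p x * P q x) - P (p + 1) x * P q x
       + \<beta> / 2 * ((\<Sum>r\<le>p. P r x * P (p - r) x * P q x) - (real p + 1) * (P p x * P q x)))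
       * laguerre_weight a \<beta> N x \<partial>lebesgue_pow N) = 0"
proof -
  let ?V = "lebesgue_pow N" and ?w = "laguerre_weight a \<beta> N"
  let ?Q = "\<lambda>k j x. \<Sum>r<Suc p. x k ^ r * x j ^ (p - r)"
  let ?d = "\<lambda>i x. real q * x i ^ p + ((\<Sum>l<N. 1 * ((real p + 1) * x l ^ p) + (a * x l ^ p + (- (x l ^ (p + 1)))))
      + (\<Sum>k<N. \<Sum>j<k. \<beta> * ?Q k j x))"
  have "(\<integral>x. (\<Sum>i<N. x i ^ q * ?d i x) * ?w x \<partial>?V) = 0"
  proof (rule unit_germ_integral_deriv[OF w _ _ _ laguerre_integral_deformed[where p=p]])
    fix i assume i: "i \<in> {..<N}"
    then show "poly_bounded N (\<lambda>x. x i ^ q)" by auto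
    show "unit_germ N (\<lambda>t x. (1 + t * x i ^ p) powr real q *
        ((\<Prod>l<N. (1 + t * ((real p + 1) * x l ^ p)) powr 1 *
            ((1 + t * x l ^ p) powr a * exp (- (t * x l ^ (p + 1))))) *
         (\<Prod>k<N. \<Prod>j<k. (1 + t * ?Q k j x) powr \<beta>))) (?d i)"
      using i
      by (intro unit_germ_mult unit_germ_prod unit_germ_powr unit_germ_exp poly_bounded_mult poly_bounded_sum
           poly_bounded_power poly_bounded_component poly_bounded_const sum_nonneg mult_nonneg_nonneg zero_le_power)
         (auto simp: less_imp_le)
  qed auto
  moreover have "(\<Sum>i<N. x i ^ q * ?d i x)
    = real q * P (p + q) x + (real p + 1 + a) * (P p x * P q x) - P (p + 1) x * P q x
       + \<beta> / 2 * ((\<Sum>r\<le>p. P r x * P (p - r) x * P q x) - (real p + 1) * (P p x * P q x))" for x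
  proof -
    \<comment> \<open>The part of \<open>?d i\<close> that does not depend on \<open>i\<close>;
      summing it against \<open>x i ^ q\<close> just multiplies it by \<open>P q x\<close>.\<close>
    define L where "L = (\<Sum>l<N. 1 * ((real p + 1) * x l ^ p) + (a * x l ^ p + (- (x l ^ (p + 1)))))
      + (\<Sum>k<N. \<Sum>j<k. \<beta> * ?Q k j x)"
    define S where "S = (\<Sum>r\<le>p. P r x * P (p - r) x)"
    have S: "(\<Sum>r\<le>p. P r x * P (p - r) x * P q x) = S * P q x"
      unfolding S_def sum_distrib_right ..
    have L: "L = (real p + 1 + a) * P p x - P (p + 1) x + \<beta> * ((S - (real p + 1) * P p x) / 2)"
      unfolding S_def P_def sum_divided_differences[symmetric] L_def
      unfolding power_sum_def sum_distrib_left
      by (simp add: sum.distrib sum_distrib_left sum_subtractf sum_negf algebra_simps)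
    have "(\<Sum>i<N. x i ^ q * ?d i x) = real q * P (p + q) x + P q x * L"
      unfolding L_def[symmetric] P_def power_sum_def
      by (simp add: sum.distrib sum_distrib_left sum_distrib_right algebra_simps power_add)
    then show ?thesis
      unfolding S L by (simp add: field_simps)
  qed
  ultimately show ?thesis by simp
qed

lemma laguerre_loop_equation:
  fixes a \<beta> :: real and N :: nat
  defines "P \<equiv> power_sum N" and "E \<equiv> \<lambda>h. \<integral>x. h x \<partial>laguerre_ensemble a \<beta> N"
  shows "real q * E (P (p + q)) + (real p + 1 + a) * E (\<lambda>x. P p x * P q x) - E (\<lambda>x. P (p + 1) x * P q x)
       + \<beta> / 2 * ((\<Sum>r\<le>p. E (\<lambda>x. P r x * P (p - r) x * P q x)) - (real p + 1) * E (\<lambda>x. P p x * P q x)) = 0"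
proof -
  let ?V = "lebesgue_pow N" and ?w = "laguerre_weight a \<beta> N" and ?Z = "laguerre_partition a \<beta> N"
  have E: "E h = (\<integral>x. h x * ?w x \<partial>?V) / ?Z" if "poly_bounded N h" for h
    unfolding E_def by (rule integral_laguerre_ensemble[OF poly_bounded_measurable[OF that]])
  have pb: "poly_bounded N (P i)" for i unfolding P_def by blast
  note pbs = pb poly_bounded_mult[OF pb pb] poly_bounded_mult[OF poly_bounded_mult[OF pb pb] pb]
  show ?thesis
  proof (cases "?Z = 0")
    case True
    then show ?thesis by (simp add: E pbs)
  next
    case False
    \<comment> \<open>The Bochner integral of a non-integrable function is \<open>0\<close>, so a
      nonzero partition function certifies integrability of the weight.\<close>
    then have w: "integrable ?V ?w"
      unfolding laguerre_partition_def using not_integrable_integral_eq by blast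
    note int = integrable_poly_bounded_laguerre_weight[OF w]
    note ints = pbs[THEN int]
    define W where "W h = (\<integral>x. h x * ?w x \<partial>?V)" for h
    have "0 = real q * W (P (p + q)) + (real p + 1 + a) * W (\<lambda>x. P p x * P q x) - W (\<lambda>x. P (p + 1) x * P q x)
       + \<beta> / 2 * ((\<Sum>r\<le>p. W (\<lambda>x. P r x * P (p - r) x * P q x)) - (real p + 1) * W (\<lambda>x. P p x * P q x))"
    proof -
      have "0 = (\<integral>x. real q * (P (p + q) x * ?w x) + (real p + 1 + a) * (P p x * P q x * ?w x)
          - P (p + 1) x * P q x * ?w x
          + \<beta> / 2 * ((\<Sum>r\<le>p. P r x * P (p - r) x * P q x * ?w x) - (real p + 1) * (P p x * P q x * ?w x)) \<partial>?V)"
        unfolding laguerre_loop_equation_weight[OF w, of q p, symmetric] P_def[symmetric] sum_distrib_right[symmetric]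
        by (intro Bochner_Integration.integral_cong refl) (simp add: algebra_simps)
      also have "\<dots> = real q * W (P (p + q)) + (real p + 1 + a) * W (\<lambda>x. P p x * P q x) - W (\<lambda>x. P (p + 1) x * P q x)
         + \<beta> / 2 * ((\<Sum>r\<le>p. W (\<lambda>x. P r x * P (p - r) x * P q x)) - (real p + 1) * W (\<lambda>x. P p x * P q x))"
        by (simp add: W_def ints)
      finally show ?thesis .
    qed
    then have "0 = (real q * W (P (p + q)) + (real p + 1 + a) * W (\<lambda>x. P p x * P q x) - W (\<lambda>x. P (p + 1) x * P q x)
       + \<beta> / 2 * ((\<Sum>r\<le>p. W (\<lambda>x. P r x * P (p - r) x * P q x)) - (real p + 1) * W (\<lambda>x. P p x * P q x))) / ?Z"
      by simp
    moreover have "E (P i) = W (P i) / ?Z" "E (\<lambda>x. P i x * P j x) = W (\<lambda>x. P i x * P j x) / ?Z"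
      "E (\<lambda>x. P i x * P j x * P k x) = W (\<lambda>x. P i x * P j x * P k x) / ?Z" for i j k
      unfolding W_def by (rule E pbs)+
    ultimately show ?thesis
      by (simp only: add_divide_distrib diff_divide_distrib sum_divide_distrib times_divide_eq_right[symmetric])
  qed
qed

section \<open>Low-order cumulants\<close>

text \<open>A partition is determined by the block \<open>insert a C\<close> containing
  \<open>a\<close> and a partition of the remaining points. This recursion enumerates the partitions
  of up to three points.\<close>

lemma Collect_partition_on_insert:
  assumes "a \<notin> A"
  shows "{P. partition_on (insert a A) P} = (\<Union>C\<in>Pow A. insert (insert a C) ` {P. partition_on (A - C) P})"
proof (intro set_eqI iffI)
  fix P assume "P \<in> {P. partition_on (insert a A) P}"
  then have P: "partition_on (insert a A) P" by simp
  then obtain B where B: "a \<in> B" "B \<in> P" "B \<subseteq> insert a A"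
    unfolding partition_on_def by blast
  have "disjnt B (\<Union>(P - {B}))"
    using partition_onD2[OF P] B(2) by (auto simp: disjnt_iff disjoint_def)
  then have "partition_on (insert a A - B) (P - {B})"
    using partition_on_insert[of B "P - {B}" "insert a A"] P B(2) by (simp add: insert_absorb)
  moreover have "insert a A - B = A - (B - {a})" "insert a (B - {a}) = B" "B - {a} \<in> Pow A"
    using B assms by auto
  moreover have "P = insert B (P - {B})" using B(2) by blast
  ultimately show "P \<in> (\<Union>C\<in>Pow A. insert (insert a C) ` {P. partition_on (A - C) P})"
    by (metis (no_types, lifting) UN_I imageI mem_Collect_eq)
next
  fix P assume "P \<in> (\<Union>C\<in>Pow A. insert (insert a C) ` {P. partition_on (A - C) P})"
  then obtain C Q where C: "C \<subseteq> A" and Q: "partition_on (A - C) Q" and P: "P = insert (insert a C) Q" by auto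
  have eq: "insert a A - insert a C = A - C" using assms by auto
  have "disjnt (insert a C) (\<Union>Q)"
    using partition_onD1[OF Q] assms by (auto simp: disjnt_iff)
  then show "P \<in> {P. partition_on (insert a A) P}"
    unfolding P using C Q by (simp add: partition_on_insert eq subset_insertI2)
qed

lemma Collect_partition_on_empty: "{P. partition_on {} P} = {{}}"
  by (simp add: partition_on_empty)

lemma joint_cumulant_singleton: "joint_cumulant M [X] = (\<integral>x. X x \<partial>M)"
proof -
  have e: "{..<length [X]} = insert 0 {}" by auto
  show ?thesis
    unfolding joint_cumulant_def e
    by (subst Collect_partition_on_insert) (simp_all add: Collect_partition_on_empty)
qed

lemma Collect_partition_on_singleton: "{P. partition_on {a} P} = {{{a}}}"
  by (subst Collect_partition_on_insert) (simp_all add: Collect_partition_on_empty)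

lemma Collect_partition_on_doubleton:
  assumes "a \<noteq> b"
  shows "{P. partition_on {a, b} P} = {{{a}, {b}}, {{a, b}}}"
  using assms
  by (subst Collect_partition_on_insert)
     (auto simp add: Collect_partition_on_empty Collect_partition_on_singleton Pow_insert insert_Diff_if)

lemma Collect_partition_on_tripleton:
  assumes "a \<noteq> b" "a \<noteq> c" "b \<noteq> c"
  shows "{P. partition_on {a, b, c} P} =
    {{{a, b, c}}, {{a, c}, {b}}, {{a, b}, {c}}, {{a}, {b}, {c}}, {{a}, {b, c}}}"
proof -
  have "Pow {b, c} = {{}, {b}, {c}, {b, c}}" by auto
  moreover have "{b, c} - {b} = {c}" "{b, c} - {c} = {b}" using assms by auto
  ultimately have "{P. partition_on {a, b, c} P} =
     {{{a}, {b}, {c}}, {{a}, {b, c}}} \<union> {{{a, b}, {c}}} \<union> {{{a, c}, {b}}} \<union> {{{a, b, c}}}"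
    using assms
    by (subst Collect_partition_on_insert)
       (simp_all add: Collect_partition_on_empty Collect_partition_on_singleton
         Collect_partition_on_doubleton Un_assoc)
  then show ?thesis by (simp only: Un_insert_left Un_empty_left Un_insert_right Un_empty_right)
qed

lemma joint_cumulant_pair: "joint_cumulant M [X, Y] = covariance M X Y"
proof -
  have e: "{..<length [X, Y]} = insert 0 (insert 1 {})" by auto
  have P: "{P. partition_on (insert 0 (insert 1 {})) P} = {{{0}, {1}}, {{0, 1::nat}}}"
    by (rule Collect_partition_on_doubleton) simp
  have "{{0}, {1}} \<noteq> {{0, 1::nat}}" by auto
  then show ?thesis
    unfolding joint_cumulant_def e P covariance_def by simp
qed

lemma joint_cumulant_triple:
  "joint_cumulant M [X, Y, Z] =
     (\<integral>x. X x * Y x * Z x \<partial>M)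
     - (\<integral>x. X x \<partial>M) * (\<integral>x. Y x * Z x \<partial>M) - (\<integral>x. Y x \<partial>M) * (\<integral>x. X x * Z x \<partial>M)
     - (\<integral>x. Z x \<partial>M) * (\<integral>x. X x * Y x \<partial>M)
     + 2 * (\<integral>x. X x \<partial>M) * (\<integral>x. Y x \<partial>M) * (\<integral>x. Z x \<partial>M)"
proof -
  let ?A = "{{0, 1, 2::nat}}" and ?B = "{{0}, {1}, {2::nat}}" and ?C = "{{0}, {1, 2::nat}}"
    and ?D = "{{0, 1}, {2::nat}}" and ?F = "{{0, 2}, {1::nat}}"
  have e: "{..<length [X, Y, Z]} = {0, 1, 2}" by auto
  have P: "{P. partition_on {0, 1, 2} P} = {?A, ?F, ?D, ?B, ?C}"
    by (rule Collect_partition_on_tripleton) simp_all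
  have ne: "{0::nat} \<noteq> {1}" "{0::nat} \<noteq> {2}" "{1::nat} \<noteq> {2}" "{0::nat} \<noteq> {1, 2}"
      "{0, 1::nat} \<noteq> {2}" "{0, 2::nat} \<noteq> {1}" by auto
  have c: "card ?A = 1" "card ?B = 3" "card ?C = 2" "card ?D = 2" "card ?F = 2"
    using ne by simp_all
  \<comment> \<open>Expanding the sum over the five partitions requires them to be distinct. The
    number of blocks separates all but the three with two blocks, and these are told apart by the
    blocks \<open>{0}\<close> and \<open>{2}\<close>.\<close>
  have "{0} \<in> ?B" "{0} \<in> ?C" "{0} \<notin> ?A" "{0} \<notin> ?D" "{0} \<notin> ?F" "{2} \<in> ?D" "{2} \<notin> ?F" by auto
  then have d: "?A \<notin> {?F, ?D, ?B, ?C}" "?F \<notin> {?D, ?B, ?C}" "?D \<notin> {?B, ?C}" "?B \<notin> {?C}"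
    using c by (metis insertE empty_iff numeral_eq_iff num.distinct one_eq_numeral_iff numeral_eq_one_iff semiring_norm(84,86,88))+
  show ?thesis
    unfolding joint_cumulant_def e P
    by (subst sum.insert, simp, rule d)+ (simp add: c ne fact_numeral mult_ac)
qed

section \<open>Large-N limit of the loop equations\<close>

text \<open>Produces the range \<open>{1..<n}\<close> of the recurrences. The term
  \<open>r = n\<close> is set apart because its cofactor will be \<open>m0 0\<close>; for
  \<open>n = 0\<close> it vanishes together with \<open>f 0\<close>.\<close>

lemma sum_convolution_split:
  fixes f g :: "nat \<Rightarrow> real"
  assumes "f 0 = 0"
  shows "(\<Sum>r\<le>n. f r * g (n - r)) = (\<Sum>r\<in>{1..<n}. f r * g (n - r)) + f n * g 0"
proof (cases n)
  case (Suc m)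
  have "{..Suc m} = insert 0 (insert (Suc m) {1..<Suc m})" by auto
  then show ?thesis using assms Suc by simp
qed (use assms in simp)

lemma sum_convolution_commute:
  fixes f :: "nat \<Rightarrow> nat \<Rightarrow> real"
  shows "(\<Sum>r\<le>n. f (n - r) r) = (\<Sum>r\<le>n. f r (n - r))"
  by (rule sum.reindex_bij_witness[of _ "\<lambda>r. n - r" "\<lambda>r. n - r"]) auto

text \<open>Both sides run over the triples of exponents with sum \<open>n\<close>; the substitution
  is \<open>p = r + b\<close>.\<close>

lemma sum_convolution_assoc:
  fixes m :: "nat \<Rightarrow> real" and \<mu> :: "nat \<Rightarrow> nat \<Rightarrow> real"
  shows "(\<Sum>p\<le>n. \<Sum>r\<le>p. m r * \<mu> (p - r) (n - p)) = (\<Sum>r\<le>n. m r * (\<Sum>b\<le>n - r. \<mu> b (n - r - b)))"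
  unfolding sum_distrib_left
  by (subst (1 2) sum.Sigma, simp, simp, simp, simp)
     (rule sum.reindex_bij_witness[of _ "\<lambda>(r, b). (r + b, r)" "\<lambda>(p, r). (r, p - r)"], auto)

text \<open>\<open>E1\<close>, \<open>E2\<close>, \<open>E3\<close> are the mixed moments of one, two and three power sums; \<open>degenerate\<close>
  leaves room for the null measure that the ensemble becomes when the integral defining its
  partition function is \<open>0\<close> or diverges (where it is \<open>0\<close> by convention).\<close>

locale loop_hierarchy =
  fixes a \<alpha> :: real
    and E1 :: "nat \<Rightarrow> nat \<Rightarrow> real" and E2 :: "nat \<Rightarrow> nat \<Rightarrow> nat \<Rightarrow> real"
    and E3 :: "nat \<Rightarrow> nat \<Rightarrow> nat \<Rightarrow> nat \<Rightarrow> real"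
    and m0 m1 :: "nat \<Rightarrow> real" and \<mu> :: "nat \<Rightarrow> nat \<Rightarrow> real"
  assumes degenerate: "\<And>N. 0 < N \<Longrightarrow> E1 0 N = real N \<or> (\<forall>p q. E1 p N = 0 \<and> E2 p q N = 0)"
    and E2_zero: "\<And>p N. E2 0 p N = real N * E1 p N"
    and E2_commute: "\<And>p q N. E2 p q N = E2 q p N"
    and loop1: "\<And>p N. 0 < N \<Longrightarrow> (real p + 1 + a) * E1 p N - E1 (p + 1) N
          + \<alpha> / real N * ((\<Sum>r\<le>p. E2 r (p - r) N) - (real p + 1) * E1 p N) = 0"
    and loop2: "\<And>p q N. 0 < N \<Longrightarrow> real q * E1 (p + q) N + (real p + 1 + a) * E2 p q N - E2 (p + 1) q N
          + \<alpha> / real N * ((\<Sum>r\<le>p. E3 r (p - r) q N) - (real p + 1) * E2 p q N) = 0"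
    and lim_m0: "\<And>p. (\<lambda>N. E1 p N / real N) \<longlonglongrightarrow> m0 p"
    and lim_m1: "\<And>p. (\<lambda>N. real N * (E1 p N / real N - m0 p)) \<longlonglongrightarrow> m1 p"
    and lim_cov: "\<And>p q. (\<lambda>N. (E2 p q N - E1 p N * E1 q N) / real N) \<longlonglongrightarrow> \<mu> p q"
    and lim_third: "\<And>p q r. (\<lambda>N. (E3 p q r N - E1 p N * E2 q r N - E1 q N * E2 p r N - E1 r N * E2 p q N
          + 2 * E1 p N * E1 q N * E1 r N) / real N ^ 2) \<longlonglongrightarrow> 0"
begin

text \<open>Mean, covariance and third cumulant in the scaling of the loop equations. The last is
  divided by \<open>real N ^ 2\<close>, which makes it vanish in the limit.\<close>

definition "e p N = E1 p N / real N"
definition "c p q N = (E2 p q N - E1 p N * E1 q N) / real N"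
definition "k p q r N = (E3 p q r N - E1 p N * E2 q r N - E1 q N * E2 p r N - E1 r N * E2 p q N
          + 2 * E1 p N * E1 q N * E1 r N) / real N ^ 2"

lemmas lims = lim_m0[folded e_def] lim_m1[folded e_def] lim_cov[folded c_def] lim_third[folded k_def]

text \<open>Passes an identity between sequences to their limits; it is asked for at positive
  \<open>N\<close> only, where division by \<open>N\<close> is genuine.\<close>

lemma lim_cong:
  assumes "f \<longlonglongrightarrow> (x::real)" "g \<longlonglongrightarrow> y" "\<And>N. 0 < N \<Longrightarrow> f N = g N"
  shows "x = y"
proof (rule LIMSEQ_unique[OF _ assms(2)])
  have "eventually (\<lambda>N. f N = g N) sequentially"
    using eventually_gt_at_top[of 0] by eventually_elim (rule assms(3))
  then show "g \<longlonglongrightarrow> x" using assms(1) by (simp add: tendsto_cong)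
qed

text \<open>The first-order correction of a product:
  \<open>N (e e' - m m') = N (e - m) e' + m N (e' - m')\<close>.\<close>

lemma lim_e_mult:
  "(\<lambda>N. real N * (e p N * e q N - m0 p * m0 q)) \<longlonglongrightarrow> m1 p * m0 q + m0 p * m1 q"
proof -
  have "(\<lambda>N. (real N * (e p N - m0 p)) * e q N + m0 p * (real N * (e q N - m0 q)))
      \<longlonglongrightarrow> m1 p * m0 q + m0 p * m1 q"
    by (intro tendsto_intros lims)
  then show ?thesis by (simp add: algebra_simps)
qed

text \<open>Replaces \<open>e 0 N = 1\<close>, which can fail in the degenerate case; there
  \<open>e p N\<close> is \<open>0\<close> instead. The next lemmas carry this weaker normalization
  to the limits, as absorption of \<open>m0 0\<close> in products.\<close>

lemma e_zero_mult: "0 < N \<Longrightarrow> e 0 N * e p N = e p N"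
  using degenerate[of N] by (auto simp: e_def)

lemma e_zero_c: "0 < N \<Longrightarrow> e 0 N * c p q N = c p q N"
  using degenerate[of N] by (auto simp: e_def c_def)

lemma m0_zero_mult: "m0 0 * m0 p = m0 p"
  by (rule lim_cong[OF tendsto_mult[OF lims(1) lims(1)] lims(1) e_zero_mult])

lemma m0_zero_\<mu>: "m0 0 * \<mu> p q = \<mu> p q"
  by (rule lim_cong[OF tendsto_mult[OF lims(1) lims(3)] lims(3) e_zero_c])

lemma m0_zero_m1: "m1 0 * m0 p + m0 0 * m1 p = m1 p"
  by (rule lim_cong[OF lim_e_mult lims(2)]) (simp add: e_zero_mult m0_zero_mult)

text \<open>Absorption gives \<open>2 * m0 0 * m1 0 = m1 0\<close>, and \<open>m0 0\<close> is
  idempotent, hence \<open>0\<close> or \<open>1\<close>; either value forces the claim.\<close>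

lemma m1_zero: "m1 0 = 0"
  using m0_zero_m1[of 0] m0_zero_mult[of 0] by auto

lemma m1_mult_m0_zero: "m1 p * m0 0 = m1 p"
  using m0_zero_m1[of p] by (simp add: m1_zero mult.commute)

lemma \<mu>_zero: "\<mu> 0 q = 0"
proof (rule lim_cong[OF lims(3) tendsto_const])
  fix N :: nat assume "0 < N"
  then show "c 0 q N = 0" using degenerate[of N] by (auto simp: c_def E2_zero)
qed

lemma \<mu>_commute: "\<mu> p q = \<mu> q p"
  by (rule lim_cong[OF lims(3) lims(3)]) (simp add: c_def E2_commute mult.commute)

lemma lim_inverse: "(\<lambda>N. 1 / real N) \<longlonglongrightarrow> 0"
  by (rule lim_1_over_n)

text \<open>\<open>loop1\<close> divided by \<open>N\<close>, with second moments split as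
  \<open>E2 / N ^ 2 = e e + c / N\<close>. It is exact at finite \<open>N\<close>; the orders
  \<open>1\<close> and \<open>1 / N\<close> are extracted from it in turn.\<close>

lemma e_recurrence:
  assumes N: "0 < N"
  shows "e (p + 1) N = (real p + 1 + a) * e p N
    + \<alpha> * ((\<Sum>r\<le>p. e r N * e (p - r) N + c r (p - r) N * (1 / real N)) - (real p + 1) * e p N * (1 / real N))"
proof -
  define S where "S = (\<Sum>r\<le>p. E2 r (p - r) N)"
  have "e r N * e (p - r) N + c r (p - r) N * (1 / real N) = E2 r (p - r) N / real N ^ 2" for r
    using N by (simp add: e_def c_def field_simps power2_eq_square)
  then have 1: "(\<Sum>r\<le>p. e r N * e (p - r) N + c r (p - r) N * (1 / real N)) = S / real N ^ 2"
    by (simp only: S_def sum_divide_distrib)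
  have 2: "E1 (p + 1) N = (real p + 1 + a) * E1 p N + \<alpha> / real N * (S - (real p + 1) * E1 p N)"
    using loop1[OF N, of p] unfolding S_def by linarith
  show ?thesis
    unfolding 1 unfolding e_def 2 using N by (simp add: field_simps power2_eq_square)
qed

lemma m0_recurrence: "m0 (p + 1) = (real p + 1 + a) * m0 p + \<alpha> * (\<Sum>r\<le>p. m0 r * m0 (p - r))"
proof -
  have "(\<lambda>N. (real p + 1 + a) * e p N
    + \<alpha> * ((\<Sum>r\<le>p. e r N * e (p - r) N + c r (p - r) N * (1 / real N)) - (real p + 1) * e p N * (1 / real N)))
    \<longlonglongrightarrow> (real p + 1 + a) * m0 p
    + \<alpha> * ((\<Sum>r\<le>p. m0 r * m0 (p - r) + \<mu> r (p - r) * 0) - (real p + 1) * m0 p * 0)"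
    by (intro tendsto_intros lims lim_inverse)
  from lim_cong[OF lims(1) this e_recurrence] show ?thesis by simp
qed

text \<open>Limit of \<open>N\<close> times the difference between \<open>e_recurrence\<close> and
  \<open>m0_recurrence\<close>.\<close>

lemma m1_recurrence_full:
  "m1 (p + 1) = (real p + 1 + a) * m1 p
    + \<alpha> * ((\<Sum>r\<le>p. (m1 r * m0 (p - r) + m0 r * m1 (p - r)) + \<mu> r (p - r)) - (real p + 1) * m0 p)"
proof -
  have "(\<lambda>N. (real p + 1 + a) * (real N * (e p N - m0 p))
    + \<alpha> * ((\<Sum>r\<le>p. real N * (e r N * e (p - r) N - m0 r * m0 (p - r)) + c r (p - r) N) - (real p + 1) * e p N))
    \<longlonglongrightarrow> (real p + 1 + a) * m1 p
    + \<alpha> * ((\<Sum>r\<le>p. (m1 r * m0 (p - r) + m0 r * m1 (p - r)) + \<mu> r (p - r)) - (real p + 1) * m0 p)"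
    by (intro tendsto_intros lims lim_e_mult)
  from lims(2)[of "p + 1"] this show ?thesis
  proof (rule lim_cong)
    fix N :: nat assume N: "0 < N"
    define S where "S = (\<Sum>r\<le>p. e r N * e (p - r) N)"
    define T where "T = (\<Sum>r\<le>p. c r (p - r) N)"
    define U where "U = (\<Sum>r\<le>p. m0 r * m0 (p - r))"
    have 1: "(\<Sum>r\<le>p. e r N * e (p - r) N + c r (p - r) N * (1 / real N)) = S + T * (1 / real N)"
      by (simp only: S_def T_def sum.distrib sum_distrib_right)
    have 2: "(\<Sum>r\<le>p. real N * (e r N * e (p - r) N - m0 r * m0 (p - r)) + c r (p - r) N) = real N * (S - U) + T"
      by (simp only: S_def T_def U_def sum.distrib sum_distrib_left[symmetric] sum_subtractf)
    show "real N * (e (p + 1) N - m0 (p + 1)) = (real p + 1 + a) * (real N * (e p N - m0 p))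
      + \<alpha> * ((\<Sum>r\<le>p. real N * (e r N * e (p - r) N - m0 r * m0 (p - r)) + c r (p - r) N) - (real p + 1) * e p N)"
      unfolding e_recurrence[OF N] m0_recurrence 1 2 U_def[symmetric]
      using N by (simp add: field_simps)
  qed
qed

text \<open>The two convolutions agree by symmetry. In each the term at \<open>m1 0\<close> vanishes
  and the one at \<open>m0 0\<close> equals \<open>m1 p\<close>, which accounts for the
  \<open>2 * \<alpha>\<close> in the coefficient of \<open>m1 p\<close>.\<close>

lemma m1_recurrence:
  "m1 (p + 1) = - \<alpha> * (real p + 1) * m0 p + (real p + 1 + a + 2 * \<alpha>) * m1 p
    + \<alpha> * (\<Sum>r\<le>p. \<mu> r (p - r)) + 2 * \<alpha> * (\<Sum>l\<in>{1..<p}. m1 l * m0 (p - l))"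
proof -
  have "(\<Sum>r\<le>p. m0 r * m1 (p - r)) = (\<Sum>r\<le>p. m1 r * m0 (p - r))"
    using sum_convolution_commute[of "\<lambda>i j. m1 i * m0 j" p] by (simp add: mult.commute)
  moreover have "(\<Sum>r\<le>p. m1 r * m0 (p - r)) = (\<Sum>r\<in>{1..<p}. m1 r * m0 (p - r)) + m1 p"
    by (simp add: sum_convolution_split[of m1, OF m1_zero] m1_mult_m0_zero)
  ultimately show ?thesis
    unfolding m1_recurrence_full sum.distrib by (simp add: algebra_simps)
qed

text \<open>\<open>loop2\<close> minus \<open>E1 q N\<close> times \<open>loop1\<close>, divided by
  \<open>N\<close>, at leading order.\<close>

lemma \<mu>_recurrence:
  "\<mu> (p + 1) q = real q * m0 (p + q) + (real p + 1 + a) * \<mu> p q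
     + \<alpha> * (\<Sum>r\<le>p. m0 r * \<mu> (p - r) q + m0 (p - r) * \<mu> r q)"
proof -
  have "(\<lambda>N. real q * e (p + q) N + (real p + 1 + a) * c p q N
     + \<alpha> * ((\<Sum>r\<le>p. k r (p - r) q N + e r N * c (p - r) q N + e (p - r) N * c r q N)
          - (real p + 1) * c p q N * (1 / real N)))
     \<longlonglongrightarrow> real q * m0 (p + q) + (real p + 1 + a) * \<mu> p q
     + \<alpha> * ((\<Sum>r\<le>p. 0 + m0 r * \<mu> (p - r) q + m0 (p - r) * \<mu> r q) - (real p + 1) * \<mu> p q * 0)"
    by (intro tendsto_intros lims lim_inverse)
  with lims(3)[of "p + 1" q]
  have "\<mu> (p + 1) q = real q * m0 (p + q) + (real p + 1 + a) * \<mu> p q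
     + \<alpha> * ((\<Sum>r\<le>p. 0 + m0 r * \<mu> (p - r) q + m0 (p - r) * \<mu> r q) - (real p + 1) * \<mu> p q * 0)"
  proof (rule lim_cong)
    fix N :: nat assume N: "0 < N"
    \<comment> \<open>This difference of moments is the third cumulant plus two products of a mean
      and a covariance; only the products survive the limit.\<close>
    have 1: "k r (p - r) q N + e r N * c (p - r) q N + e (p - r) N * c r q N
        = (E3 r (p - r) q N - E2 r (p - r) N * E1 q N) / real N ^ 2" for r
      using N by (simp add: k_def e_def c_def field_simps power2_eq_square)
    define S where "S = (\<Sum>r\<le>p. E3 r (p - r) q N)"
    define T where "T = (\<Sum>r\<le>p. E2 r (p - r) N)"
    have 2: "(\<Sum>r\<le>p. k r (p - r) q N + e r N * c (p - r) q N + e (p - r) N * c r q N)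
        = (S - T * E1 q N) / real N ^ 2"
      unfolding 1 S_def T_def by (simp add: sum_divide_distrib[symmetric] sum_subtractf sum_distrib_right)
    have l1: "E1 (p + 1) N = (real p + 1 + a) * E1 p N + \<alpha> / real N * (T - (real p + 1) * E1 p N)"
      using loop1[OF N, of p] unfolding T_def by linarith
    have l2: "E2 (p + 1) q N = real q * E1 (p + q) N + (real p + 1 + a) * E2 p q N
        + \<alpha> / real N * (S - (real p + 1) * E2 p q N)"
      using loop2[OF N, of q p] unfolding S_def by linarith
    show "c (p + 1) q N = real q * e (p + q) N + (real p + 1 + a) * c p q N
     + \<alpha> * ((\<Sum>r\<le>p. k r (p - r) q N + e r N * c (p - r) q N + e (p - r) N * c r q N)
          - (real p + 1) * c p q N * (1 / real N))"
      unfolding 2 unfolding c_def e_def l1 l2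
      using N by (simp add: field_simps power2_eq_square)
  qed
  then show ?thesis by simp
qed

text \<open>Sum of \<open>\<mu>_recurrence\<close> over \<open>p + q = n\<close>. Both double sums
  become the same convolution of \<open>\<nu>\<close> with \<open>m0\<close>; its last term,
  \<open>\<nu> n\<close>, joins the leading coefficient.\<close>

lemma summed_\<mu>_recurrence:
  defines "\<nu> \<equiv> \<lambda>n. \<Sum>p\<le>n. \<mu> p (n - p)"
  shows "\<nu> (n + 1) = (1 / 2) * (real n + 2 + 2 * a + 4 * \<alpha>) * \<nu> n + (real n * (real n + 1) / 2) * m0 n
     + 2 * \<alpha> * (\<Sum>s\<in>{1..<n}. \<nu> s * m0 (n - s))"
proof -
  have \<nu>0: "\<nu> 0 = 0" by (simp add: \<nu>_def \<mu>_zero)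
  have \<nu>m: "\<nu> n * m0 0 = \<nu> n"
    unfolding \<nu>_def sum_distrib_right by (simp add: m0_zero_\<mu> mult.commute[of _ "m0 0"])
  \<comment> \<open>The shift of the index drops the term \<open>p = 0\<close>, which is
    \<open>0\<close> by \<open>\<mu>_zero\<close>.\<close>
  have "\<nu> (n + 1) = (\<Sum>p\<le>n. \<mu> (p + 1) (n - p))"
    unfolding \<nu>_def by (simp add: sum.atMost_Suc_shift \<mu>_zero del: sum.atMost_Suc)
  also have "\<dots> = (\<Sum>p\<le>n. real (n - p)) * m0 n + (\<Sum>p\<le>n. (real p + 1 + a) * \<mu> p (n - p))
     + \<alpha> * ((\<Sum>p\<le>n. \<Sum>r\<le>p. m0 r * \<mu> (p - r) (n - p)) + (\<Sum>p\<le>n. \<Sum>r\<le>p. m0 (p - r) * \<mu> r (n - p)))"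
  proof -
    have "(\<Sum>p\<le>n. \<mu> (p + 1) (n - p)) = (\<Sum>p\<le>n. real (n - p) * m0 n + (real p + 1 + a) * \<mu> p (n - p)
       + \<alpha> * (\<Sum>r\<le>p. m0 r * \<mu> (p - r) (n - p) + m0 (p - r) * \<mu> r (n - p)))"
      unfolding \<mu>_recurrence by (intro sum.cong refl) simp
    then show ?thesis
      by (simp only: sum.distrib sum_distrib_left[symmetric] sum_distrib_right[symmetric])
  qed
  also have "(\<Sum>p\<le>n. \<Sum>r\<le>p. m0 (p - r) * \<mu> r (n - p)) = (\<Sum>p\<le>n. \<Sum>r\<le>p. m0 r * \<mu> (p - r) (n - p))"
    by (intro sum.cong refl sum_convolution_commute[of "\<lambda>i j. m0 i * \<mu> j x" for x])
  also have "(\<Sum>p\<le>n. \<Sum>r\<le>p. m0 r * \<mu> (p - r) (n - p)) = (\<Sum>s\<le>n. \<nu> s * m0 (n - s))"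
    unfolding sum_convolution_assoc \<nu>_def[symmetric]
    using sum_convolution_commute[of "\<lambda>i j. \<nu> i * m0 j" n] unfolding \<nu>_def by (simp add: mult.commute)
  also have "(\<Sum>s\<le>n. \<nu> s * m0 (n - s)) = (\<Sum>s\<in>{1..<n}. \<nu> s * m0 (n - s)) + \<nu> n"
    by (simp add: sum_convolution_split[of \<nu>, OF \<nu>0] \<nu>m)
  also have "(\<Sum>p\<le>n. real (n - p)) = real n * (real n + 1) / 2"
  proof -
    have "(\<Sum>p\<le>n. real p) = real n * (real n + 1) / 2"
      by (induction n) (auto simp: field_simps)
    then show ?thesis using sum_convolution_commute[of "\<lambda>i j. real i" n] by simp
  qed
  also have "(\<Sum>p\<le>n. (real p + 1 + a) * \<mu> p (n - p)) = (real n / 2 + 1 + a) * \<nu> n"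
  proof -
    \<comment> \<open>Since \<open>\<mu>\<close> is symmetric, the weight \<open>p\<close> may be
      exchanged for \<open>n - p\<close>, hence averages to \<open>n / 2\<close>. This is the source
      of the factor \<open>1 / 2\<close> in the recurrence.\<close>
    have "(\<Sum>p\<le>n. real p * \<mu> p (n - p)) = (\<Sum>p\<le>n. real (n - p) * \<mu> p (n - p))"
      using sum_convolution_commute[of "\<lambda>i j. real i * \<mu> i j" n] by (simp add: \<mu>_commute[of "n - _"])
    also have "\<dots> = real n * \<nu> n - (\<Sum>p\<le>n. real p * \<mu> p (n - p))"
      unfolding \<nu>_def sum_distrib_left sum_subtractf[symmetric]
      by (intro sum.cong refl) (simp add: of_nat_diff algebra_simps)
    finally have "(\<Sum>p\<le>n. real p * \<mu> p (n - p)) = real n / 2 * \<nu> n" by simp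
    moreover have "(\<Sum>p\<le>n. (real p + 1 + a) * \<mu> p (n - p))
        = (\<Sum>p\<le>n. real p * \<mu> p (n - p)) + \<nu> n + a * \<nu> n"
      unfolding \<nu>_def by (simp add: sum.distrib sum_distrib_left ring_distribs)
    ultimately show ?thesis by (simp add: algebra_simps)
  qed
  finally show ?thesis by (simp add: field_simps)
qed

end

section \<open>Limits of means and cumulants of the ensemble under the ansatz\<close>

lemma bigo_mult_tendsto_zero:
  fixes f g h :: "nat \<Rightarrow> real"
  assumes "f \<in> O(g)" and "(\<lambda>n. h n * g n) \<longlonglongrightarrow> 0"
  shows "(\<lambda>n. h n * f n) \<longlonglongrightarrow> 0"
proof -
  obtain C where C: "eventually (\<lambda>n. norm (f n) \<le> C * norm (g n)) sequentially"
    using assms(1) by (elim landau_o.bigE)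
  show ?thesis
  proof (rule Lim_null_comparison)
    show "eventually (\<lambda>n. norm (h n * f n) \<le> C * norm (h n * g n)) sequentially"
      using C
    proof eventually_elim
      case (elim n)
      then have "norm (h n) * norm (f n) \<le> norm (h n) * (C * norm (g n))" by (rule mult_left_mono) simp
      then show ?case by (simp add: abs_mult mult_ac)
    qed
    show "(\<lambda>n. C * norm (h n * g n)) \<longlonglongrightarrow> 0"
      using tendsto_mult[OF tendsto_const tendsto_norm_zero[OF assms(2)], of C] by simp
  qed
qed

lemma tendsto_cong_pos:
  fixes f g :: "nat \<Rightarrow> real"
  assumes "f \<longlonglongrightarrow> x" and "\<And>N. 0 < N \<Longrightarrow> f N = g N"
  shows "g \<longlonglongrightarrow> x"
  by (rule Lim_transform_eventually[OF assms(1)])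
     (use eventually_gt_at_top[of 0] in \<open>eventually_elim; use assms(2) in blast\<close>)

context
  fixes a \<alpha> :: real
begin

definition "mean p N = (\<integral>x. power_sum N p x \<partial>laguerre_high_temp a \<alpha> N)"
definition "mean2 p q N = (\<integral>x. power_sum N p x * power_sum N q x \<partial>laguerre_high_temp a \<alpha> N)"
definition "mean3 p q r N = (\<integral>x. power_sum N p x * power_sum N q x * power_sum N r x \<partial>laguerre_high_temp a \<alpha> N)"

lemma moment_expansion_tendsto:
  assumes "moment_expansion a \<alpha> p m0 m1"
  shows "(\<lambda>N. mean p N / real N) \<longlonglongrightarrow> m0"
    and "(\<lambda>N. real N * (mean p N / real N - m0)) \<longlonglongrightarrow> m1"
proof -
  define R where "R N = mean p N / real N - (m0 + m1 / real N)" for N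
  have R: "R \<in> O(\<lambda>N. 1 / real N ^ 2)"
    using assms unfolding moment_expansion_def R_def[abs_def] mean_def .
  have "(\<lambda>N. real N * (1 / real N ^ 2)) \<longlonglongrightarrow> 0" by real_asymp
  from bigo_mult_tendsto_zero[OF R this]
  have "(\<lambda>N. real N * R N + m1) \<longlonglongrightarrow> 0 + m1" by (intro tendsto_intros)
  then have "(\<lambda>N. real N * R N + m1) \<longlonglongrightarrow> m1" by simp
  then show *: "(\<lambda>N. real N * (mean p N / real N - m0)) \<longlonglongrightarrow> m1"
    by (rule tendsto_cong_pos) (simp add: R_def field_simps)
  have "(\<lambda>N. 1 / real N * (real N * (mean p N / real N - m0)) + m0) \<longlonglongrightarrow> 0 * m1 + m0"
    by (intro tendsto_intros * lim_1_over_n)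
  then show "(\<lambda>N. mean p N / real N) \<longlonglongrightarrow> m0"
    by (simp, elim tendsto_cong_pos) simp
qed

text \<open>Both coefficients are limits of sequences built from the means, hence unique; this
  justifies the definite descriptions.\<close>

lemma moments_eq:
  assumes "moment_expansion a \<alpha> p m0 m1"
  shows "moment0 a \<alpha> p = m0" and "moment1 a \<alpha> p = m1"
proof -
  have u: "m0' = m0 \<and> m1' = m1" if m': "moment_expansion a \<alpha> p m0' m1'" for m0' m1'
  proof -
    have 0: "m0' = m0"
      using LIMSEQ_unique moment_expansion_tendsto(1)[OF m'] moment_expansion_tendsto(1)[OF assms] by blast
    with LIMSEQ_unique moment_expansion_tendsto(2)[OF m'] moment_expansion_tendsto(2)[OF assms]
    show ?thesis by blast
  qed
  show "moment0 a \<alpha> p = m0"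
    unfolding moment0_def by (rule the_equality) (use assms u in blast)+
  show "moment1 a \<alpha> p = m1"
    unfolding moment1_def by (rule the_equality) (use assms u in blast)+
qed

lemma mean_loop_equation:
  assumes N: "0 < N"
  shows "real q * mean (p + q) N + (real p + 1 + a) * mean2 p q N - mean2 (p + 1) q N
    + \<alpha> / real N * ((\<Sum>r\<le>p. mean3 r (p - r) q N) - (real p + 1) * mean2 p q N) = 0"
  using laguerre_loop_equation[where q=q and p=p and N=N and a=a and \<beta>="2 * \<alpha> / real N"]
  by (simp add: mean_def mean2_def mean3_def laguerre_high_temp_def)

lemma power_sum_zero: "power_sum N 0 x = real N"
  by (simp add: power_sum_def)

lemma mean2_commute: "mean2 p q N = mean2 q p N"
  by (simp add: mean2_def mult.commute)

lemma mean2_zero: "mean2 0 p N = real N * mean p N" "mean2 p 0 N = real N * mean p N"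
  and mean3_zero: "mean3 p q 0 N = real N * mean2 p q N"
  by (simp_all add: mean_def mean2_def mean3_def power_sum_zero)

text \<open>The case \<open>q = 0\<close>: the power sum of exponent \<open>0\<close> is the
  constant \<open>N\<close>, a common factor that cancels.\<close>

lemma mean_loop_equation_zero:
  assumes N: "0 < N"
  shows "(real p + 1 + a) * mean p N - mean (p + 1) N
    + \<alpha> / real N * ((\<Sum>r\<le>p. mean2 r (p - r) N) - (real p + 1) * mean p N) = 0"
proof -
  have "real N * ((real p + 1 + a) * mean p N - mean (p + 1) N
    + \<alpha> / real N * ((\<Sum>r\<le>p. mean2 r (p - r) N) - (real p + 1) * mean p N)) = 0"
    using mean_loop_equation[OF N, of 0 p]
    unfolding mean2_zero mean3_zero sum_distrib_left[symmetric]
    using N by (simp add: algebra_simps)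
  then show ?thesis using N by simp
qed

text \<open>If the partition function is \<open>0\<close>, all means are quotients by
  \<open>0\<close>; otherwise the total mass is \<open>1\<close> and the constant \<open>N\<close>
  has mean \<open>N\<close>.\<close>

lemma mean_degenerate: "mean 0 N = real N \<or> (\<forall>p q. mean p N = 0 \<and> mean2 p q N = 0)"
proof (cases "laguerre_partition a (2 * \<alpha> / real N) N = 0")
  case True
  have "poly_bounded N (power_sum N p)" "poly_bounded N (\<lambda>x. power_sum N p x * power_sum N q x)" for p q
    by blast+
  then show ?thesis
    using True unfolding mean_def mean2_def laguerre_high_temp_def
    by (simp add: integral_laguerre_ensemble poly_bounded_measurable)
next
  case False
  then have "mean 0 N = real N"
    unfolding mean_def laguerre_high_temp_def power_sum_zero
    by (subst integral_laguerre_ensemble) (auto simp: laguerre_partition_def)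
  then show ?thesis ..
qed

context
  assumes ansatz: "large_N_ansatz a \<alpha>"
begin

lemma cumulant_expansion:
  assumes "ps \<noteq> []"
  obtains c where "\<And>L. (\<lambda>N. joint_cumulant (laguerre_high_temp a \<alpha> N) (map (power_sum N) ps)
                - real N * (\<Sum>l<L. c l / real N ^ l)) \<in> O(\<lambda>N. real N / real N ^ L)"
  using ansatz assms unfolding large_N_ansatz_def by blast

text \<open>The first cumulant is the mean, so the ansatz truncated at \<open>L = 2\<close> and
  divided by \<open>N\<close> is the required expansion, with coefficients \<open>c 0\<close> and
  \<open>c 1\<close>.\<close>

lemma moment_expansion_moments: "moment_expansion a \<alpha> p (moment0 a \<alpha> p) (moment1 a \<alpha> p)"
proof -
  obtain c where c: "\<And>L. (\<lambda>N. joint_cumulant (laguerre_high_temp a \<alpha> N) (map (power_sum N) [p])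
                - real N * (\<Sum>l<L. c l / real N ^ l)) \<in> O(\<lambda>N. real N / real N ^ L)"
    using cumulant_expansion[of "[p]"] by blast
  have "(\<lambda>N. mean p N - real N * (c 0 + c 1 / real N)) \<in> O(\<lambda>N. real N / real N ^ 2)"
    using c[of 2] by (simp add: joint_cumulant_singleton mean_def numeral_2_eq_2)
  then obtain C where "0 < C" and
    C: "eventually (\<lambda>N. norm (mean p N - real N * (c 0 + c 1 / real N)) \<le> C * norm (real N / real N ^ 2)) sequentially"
    by (elim landau_o.bigE)
  have "moment_expansion a \<alpha> p (c 0) (c 1)"
    unfolding moment_expansion_def mean_def[symmetric]
  proof (rule landau_o.bigI[OF \<open>0 < C\<close>])
    show "eventually (\<lambda>N. norm (mean p N / real N - (c 0 + c 1 / real N)) \<le> C * norm (1 / real N ^ 2)) sequentially"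
      using C eventually_gt_at_top[of 0]
    proof eventually_elim
      case (elim N)
      have "mean p N / real N - (c 0 + c 1 / real N) = (mean p N - real N * (c 0 + c 1 / real N)) / real N"
        using elim by (simp add: field_simps)
      then have "norm (mean p N / real N - (c 0 + c 1 / real N)) = norm (mean p N - real N * (c 0 + c 1 / real N)) / real N"
        by simp
      also have "\<dots> \<le> C * norm (real N / real N ^ 2) / real N"
        using elim by (intro divide_right_mono) auto
      also have "\<dots> = C * norm (1 / real N ^ 2)"
        using elim by (simp add: field_simps power2_eq_square)
      finally show ?case .
    qed
  qed
  then show ?thesis using moments_eq by simp
qed

text \<open>Truncation of the second cumulant at \<open>L = 1\<close> shows convergence, so the
  \<open>lim\<close> in \<open>cov0\<close> is an actual limit.\<close>

lemma covariance_tendsto: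
  "(\<lambda>N. (mean2 p q N - mean p N * mean q N) / real N) \<longlonglongrightarrow> cov0 a \<alpha> p q"
proof -
  obtain c where c: "\<And>L. (\<lambda>N. joint_cumulant (laguerre_high_temp a \<alpha> N) (map (power_sum N) [p, q])
                - real N * (\<Sum>l<L. c l / real N ^ l)) \<in> O(\<lambda>N. real N / real N ^ L)"
    using cumulant_expansion[of "[p, q]"] by blast
  have eq: "covariance (laguerre_high_temp a \<alpha> N) (power_sum N p) (power_sum N q)
      = mean2 p q N - mean p N * mean q N" for N
    by (simp add: covariance_def mean_def mean2_def)
  have b: "(\<lambda>N. mean2 p q N - mean p N * mean q N - real N * c 0) \<in> O(\<lambda>N. real N / real N ^ 1)"
    using c[of 1] by (simp add: joint_cumulant_pair eq)
  have "(\<lambda>N. 1 / real N * (real N / real N ^ 1)) \<longlonglongrightarrow> 0" by real_asymp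
  from bigo_mult_tendsto_zero[OF b this]
  have "(\<lambda>N. 1 / real N * (mean2 p q N - mean p N * mean q N - real N * c 0) + c 0) \<longlonglongrightarrow> 0 + c 0"
    by (intro tendsto_intros)
  then have "(\<lambda>N. 1 / real N * (mean2 p q N - mean p N * mean q N - real N * c 0) + c 0) \<longlonglongrightarrow> c 0"
    by (simp only: add_0)
  then have "(\<lambda>N. (mean2 p q N - mean p N * mean q N) / real N) \<longlonglongrightarrow> c 0"
    by (rule tendsto_cong_pos) (simp add: field_simps)
  then show ?thesis unfolding cov0_def eq by (simp add: limI)
qed

text \<open>Truncation at \<open>L = 0\<close> already bounds the third cumulant by a multiple of
  \<open>N\<close>, negligible against \<open>N ^ 2\<close>.\<close>

lemma third_cumulant_tendsto:
  "(\<lambda>N. (mean3 p q r N - mean p N * mean2 q r N - mean q N * mean2 p r N - mean r N * mean2 p q N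
          + 2 * mean p N * mean q N * mean r N) / real N ^ 2) \<longlonglongrightarrow> 0" (is "(\<lambda>N. ?k N / _) \<longlonglongrightarrow> 0")
proof -
  obtain c where c: "\<And>L. (\<lambda>N. joint_cumulant (laguerre_high_temp a \<alpha> N) (map (power_sum N) [p, q, r])
                - real N * (\<Sum>l<L. c l / real N ^ l)) \<in> O(\<lambda>N. real N / real N ^ L)"
    using cumulant_expansion[of "[p, q, r]"] by blast
  have b: "?k \<in> O(\<lambda>N. real N)"
    using c[of 0] by (simp add: joint_cumulant_triple mean_def mean2_def mean3_def)
  have "(\<lambda>N. 1 / real N ^ 2 * real N) \<longlonglongrightarrow> 0" by real_asymp
  from bigo_mult_tendsto_zero[OF b this] show ?thesis by simp
qed

lemma loop_hierarchy_laguerre: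
  "loop_hierarchy a \<alpha> mean mean2 mean3 (moment0 a \<alpha>) (moment1 a \<alpha>) (cov0 a \<alpha>)"
  by unfold_locales
     (rule mean_degenerate mean2_zero mean2_commute mean_loop_equation mean_loop_equation_zero covariance_tendsto
      moment_expansion_tendsto[OF moment_expansion_moments] third_cumulant_tendsto; assumption)+

end

end

lemma summed_cov0_eq: "summed_cov0 a \<alpha> n = (\<Sum>p\<le>n. cov0 a \<alpha> p (n - p))"
  unfolding summed_cov0_def
  by (rule sum.reindex_bij_witness[of _ "\<lambda>p. (p, n - p)" fst]) auto

theorem mainTheorem6:
  fixes \<alpha>\<^sub>1 \<alpha> :: real
  assumes "\<alpha>\<^sub>1 > -1"
    and "\<alpha> > - min 1 (1 + \<alpha>\<^sub>1)"
    and "large_N_ansatz \<alpha>\<^sub>1 \<alpha>"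
  shows "moment1 \<alpha>\<^sub>1 \<alpha> 0 = 0 \<and>
         (\<forall>p::nat. moment1 \<alpha>\<^sub>1 \<alpha> (p + 1) =
           - \<alpha> * (real p + 1) * moment0 \<alpha>\<^sub>1 \<alpha> p
           + (real p + 1 + \<alpha>\<^sub>1 + 2 * \<alpha>) * moment1 \<alpha>\<^sub>1 \<alpha> p
           + \<alpha> * summed_cov0 \<alpha>\<^sub>1 \<alpha> p
           + 2 * \<alpha> * (\<Sum>l\<in>{1..<p}. moment1 \<alpha>\<^sub>1 \<alpha> l * moment0 \<alpha>\<^sub>1 \<alpha> (p - l))) \<and>
         summed_cov0 \<alpha>\<^sub>1 \<alpha> 0 = 0 \<and>
         (\<forall>p::nat. summed_cov0 \<alpha>\<^sub>1 \<alpha> (p + 1) =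
           (1 / 2) * (real p + 2 + 2 * \<alpha>\<^sub>1 + 4 * \<alpha>) * summed_cov0 \<alpha>\<^sub>1 \<alpha> p
           + (real p * (real p + 1) / 2) * moment0 \<alpha>\<^sub>1 \<alpha> p
           + 2 * \<alpha> * (\<Sum>s\<in>{1..<p}. summed_cov0 \<alpha>\<^sub>1 \<alpha> s * moment0 \<alpha>\<^sub>1 \<alpha> (p - s)))"
proof -
  interpret loop_hierarchy \<alpha>\<^sub>1 \<alpha> "mean \<alpha>\<^sub>1 \<alpha>" "mean2 \<alpha>\<^sub>1 \<alpha>" "mean3 \<alpha>\<^sub>1 \<alpha>"
    "moment0 \<alpha>\<^sub>1 \<alpha>" "moment1 \<alpha>\<^sub>1 \<alpha>" "cov0 \<alpha>\<^sub>1 \<alpha>"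
    using assms(3) by (rule loop_hierarchy_laguerre)
  show ?thesis
  proof (intro conjI allI)
    show "moment1 \<alpha>\<^sub>1 \<alpha> 0 = 0" by (rule m1_zero)
    show "summed_cov0 \<alpha>\<^sub>1 \<alpha> 0 = 0" by (simp add: summed_cov0_eq \<mu>_zero)
    fix p :: nat
    show "moment1 \<alpha>\<^sub>1 \<alpha> (p + 1) =
           - \<alpha> * (real p + 1) * moment0 \<alpha>\<^sub>1 \<alpha> p
           + (real p + 1 + \<alpha>\<^sub>1 + 2 * \<alpha>) * moment1 \<alpha>\<^sub>1 \<alpha> p
           + \<alpha> * summed_cov0 \<alpha>\<^sub>1 \<alpha> p
           + 2 * \<alpha> * (\<Sum>l\<in>{1..<p}. moment1 \<alpha>\<^sub>1 \<alpha> l * moment0 \<alpha>\<^sub>1 \<alpha> (p - l))"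
      unfolding summed_cov0_eq by (rule m1_recurrence)
    show "summed_cov0 \<alpha>\<^sub>1 \<alpha> (p + 1) =
           (1 / 2) * (real p + 2 + 2 * \<alpha>\<^sub>1 + 4 * \<alpha>) * summed_cov0 \<alpha>\<^sub>1 \<alpha> p
           + (real p * (real p + 1) / 2) * moment0 \<alpha>\<^sub>1 \<alpha> p
           + 2 * \<alpha> * (\<Sum>s\<in>{1..<p}. summed_cov0 \<alpha>\<^sub>1 \<alpha> s * moment0 \<alpha>\<^sub>1 \<alpha> (p - s))"
      unfolding summed_cov0_eq by (rule summed_\<mu>_recurrence)
  qed
qed

end
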